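(* Let $m,n\ge1$ be integers, $d=m+n$, let $A$ be a real $m\times n$ matrix, and suppose that $\sum_{k=1}^{\infty}\Delta_k(A)=\infty$. Then, for every $v>0$, \[ \dim_H W_A(\psi_v)=\min\left\{m,\frac nv\right\}, \] where $\psi_v(q):=q^{-v}$. In particular, this formula holds for every $v>0$ whenever $A$ is nonsingular.
   Context: Norms $|\cdot|$ are supremum norms; $\mathbb T^m=\mathbb R^m/\mathbb Z^m$ with the induced metric; $|\mathbf x|_{\mathbb Z^m}:=\min_{\mathbf p\in\mathbb Z^m}|\mathbf x-\mathbf p|$; $\dim_H$ is Hausdorff dimension. For $\psi:(0,\infty)\to(0,\infty)$, $W_A(\psi)$ is the set of $\mathbf b\in\mathbb T^m$ such that $|A\mathbf q-\mathbf b|_{\mathbb Z^m}<\psi(|\mathbf q|)$ holds for infinitely many distinct $\mathbf q\in\mathbb Z^n\setminus\{\mathbf 0\}$. $A$ is singular if for every $\varepsilon>0$ and all sufficiently large $Q$ there is $\mathbf q\in\mathbb Z^n$ with $0<|\mathbf q|\le Q$ and $|A\mathbf q|_{\mathbb Z^m}<\varepsilon Q^{-n/m}$. Otherwise $A$ is nonsingular. (Here $A$ is not necessarily square; this is not invertibility.) Let \[ \Lambda_A=u_A\mathbb Z^d,\quad u_A=\begin{pmatrix}I_m&A\\0&I_n\end{pmatrix},\quad a_t=\begin{pmatrix}e^{t/m}I_m&0\\0&e^{-t/n}I_n\end{pmatrix}, \] and for a lattice $\Lambda\subset\mathbb R^d$ and $1\le i\le d$ let $\lambda_i(\Lambda):=\inf\{\rho>0:\Lambda\cap[-\rho,\rho]^d\text{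 contains } i\text{ linearly independent vectors}\}$. Define \[ \Delta_k(A):=\prod_{i=1}^{d}\min\{1,\lambda_i(a_{nk\log 2}\Lambda_A)\}. \] *)

theory Defs
  imports "HOL-Analysis.Analysis"
begin

text \<open>
  The integers \<open>m\<close> and \<open>n\<close> are the cardinalities of finite index types \<open>'m\<close> and \<open>'n\<close> (which are
  automatically nonempty), and \<open>'m + 'n\<close> indexes the coordinates of \<open>d\<close>-space for \<open>d = m + n\<close>.
  The norm is always the supremum norm \<^const>\<open>infnorm\<close>, not the Euclidean \<^const>\<open>norm\<close>.
\<close>

definition int_vecs :: "(real^'k) set" where
  "int_vecs = {x. \<forall>i. x $ i \<in> \<int>}"

definition dist_int :: "real^'k \<Rightarrow> real" where
  "dist_int x = (INF p\<in>int_vecs. infnorm (x - p))"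

lemma int_vecs_0 [simp]: "0 \<in> int_vecs"
  by (simp add: int_vecs_def)

lemma int_vecs_add: "x \<in> int_vecs \<Longrightarrow> y \<in> int_vecs \<Longrightarrow> x + y \<in> int_vecs"
  by (simp add: int_vecs_def)

lemma int_vecs_diff: "x \<in> int_vecs \<Longrightarrow> y \<in> int_vecs \<Longrightarrow> x - y \<in> int_vecs"
  by (simp add: int_vecs_def)

lemma int_vecs_uminus: "x \<in> int_vecs \<Longrightarrow> - x \<in> int_vecs"
  by (simp add: int_vecs_def)

lemma infnorm_mono_cart:
  fixes x y :: "real^'k"
  assumes "\<And>i. \<bar>x $ i\<bar> \<le> \<bar>y $ i\<bar>"
  shows "infnorm x \<le> infnorm y"
  unfolding infnorm_cart[of x]
proof (rule cSup_least)
  show "{\<bar>x $ i\<bar> |i. i \<in> UNIV} \<noteq> {}" by auto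
  show "\<And>a. a \<in> {\<bar>x $ i\<bar> |i. i \<in> UNIV} \<Longrightarrow> a \<le> infnorm y"
    using assms component_le_infnorm_cart order_trans by blast
qed

lemma dist_int_le: "p \<in> int_vecs \<Longrightarrow> dist_int x \<le> infnorm (x - p)"
  unfolding dist_int_def by (rule cINF_lower) (auto intro!: bdd_belowI[of _ 0] simp: infnorm_pos_le)

lemma dist_int_attained:
  fixes x :: "real^'k"
  shows "\<exists>p\<in>int_vecs. dist_int x = infnorm (x - p)"
proof -
  define p :: "real^'k" where "p = (\<chi> i. of_int (round (x $ i)))"
  have p: "p \<in> int_vecs" by (simp add: p_def int_vecs_def)
  have "infnorm (x - p) \<le> infnorm (x - r)" if "r \<in> int_vecs" for r
  proof (rule infnorm_mono_cart)
    fix i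
    obtain z where "r $ i = of_int z"
      using \<open>r \<in> int_vecs\<close> by (auto simp: int_vecs_def elim: Ints_cases)
    then show "\<bar>(x - p) $ i\<bar> \<le> \<bar>(x - r) $ i\<bar>"
      by (simp add: p_def round_diff_minimal)
  qed
  then have "infnorm (x - p) \<le> dist_int x"
    unfolding dist_int_def by (intro cINF_greatest) (auto intro: int_vecs_0)
  with p dist_int_le[OF p, of x] show ?thesis by (intro bexI[of _ p]) auto
qed

lemma dist_int_nonneg: "0 \<le> dist_int x"
  using dist_int_attained[of x] infnorm_pos_le by auto

lemma dist_int_eq_0_iff: "dist_int x = 0 \<longleftrightarrow> x \<in> int_vecs"
proof
  assume "dist_int x = 0"
  then show "x \<in> int_vecs"
    using dist_int_attained[of x] by (auto simp: infnorm_eq_0)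
next
  assume "x \<in> int_vecs"
  then show "dist_int x = 0"
    using dist_int_le[of x x] dist_int_nonneg[of x] by (simp add: infnorm_0)
qed

lemma dist_int_triangle: "dist_int (x + y) \<le> dist_int x + dist_int y"
proof -
  obtain p q where p: "p \<in> int_vecs" "dist_int x = infnorm (x - p)"
    and q: "q \<in> int_vecs" "dist_int y = infnorm (y - q)"
    using dist_int_attained by metis
  have "dist_int (x + y) \<le> infnorm ((x - p) + (y - q))"
    using dist_int_le[OF int_vecs_add[OF p(1) q(1)], of "x + y"] by (simp add: algebra_simps)
  also have "\<dots> \<le> dist_int x + dist_int y"
    by (simp add: p q infnorm_triangle)
  finally show ?thesis .
qed

lemma dist_int_uminus: "dist_int (- x) = dist_int x"
proof -
  have le: "dist_int (- y) \<le> dist_int y" for y :: "real^'k"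
  proof -
    obtain p where p: "p \<in> int_vecs" "dist_int y = infnorm (y - p)"
      using dist_int_attained by metis
    have "dist_int (- y) \<le> infnorm (- y - (- p))"
      by (rule dist_int_le) (rule int_vecs_uminus[OF p(1)])
    also have "\<dots> = infnorm (- (y - p))" by simp
    finally show ?thesis by (simp only: infnorm_neg p(2))
  qed
  from le[of x] le[of "- x"] show ?thesis by simp
qed

lemma dist_int_cong:
  assumes "x - y \<in> int_vecs"
  shows "dist_int x = dist_int y"
proof -
  have "dist_int (x - y) = 0" "dist_int (y - x) = 0"
    using assms int_vecs_uminus[OF assms] by (simp_all add: dist_int_eq_0_iff)
  then show ?thesis
    using dist_int_triangle[of "x - y" y] dist_int_triangle[of "y - x" x] by simp
qed

quotient_type (overloaded) 'm torus = "real^'m" / "\<lambda>x y. x - y \<in> int_vecs"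
  morphisms rep_torus torus_of
proof (rule equivpI)
  show "reflp (\<lambda>x y :: real^'m. x - y \<in> int_vecs)"
    by (simp add: reflp_def)
  show "symp (\<lambda>x y :: real^'m. x - y \<in> int_vecs)"
    using int_vecs_uminus by (force simp: symp_def)
  show "transp (\<lambda>x y :: real^'m. x - y \<in> int_vecs)"
    using int_vecs_add by (force simp: transp_def)
qed

instantiation torus :: (finite) metric_space
begin

lift_definition dist_torus :: "'a torus \<Rightarrow> 'a torus \<Rightarrow> real" is "\<lambda>x y. dist_int (x - y)"
proof -
  fix x x' y y' :: "real^'a"
  assume "x - x' \<in> int_vecs" "y - y' \<in> int_vecs"
  then have "(x - x') - (y - y') \<in> int_vecs" by (rule int_vecs_diff)
  then show "dist_int (x - y) = dist_int (x' - y')"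
    by (intro dist_int_cong) (simp add: algebra_simps)
qed

definition uniformity_torus :: "('a torus \<times> 'a torus) filter" where
  "uniformity_torus = (INF e\<in>{0 <..}. principal {(x, y). dist x y < e})"

definition open_torus :: "'a torus set \<Rightarrow> bool" where
  "open_torus U \<longleftrightarrow> (\<forall>x\<in>U. \<forall>\<^sub>F (x', y) in uniformity. x' = x \<longrightarrow> y \<in> U)"

instance
proof
  show "dist x y = 0 \<longleftrightarrow> x = y" for x y :: "'a torus"
    by transfer (rule dist_int_eq_0_iff)
  show "dist x y \<le> dist x z + dist y z" for x y z :: "'a torus"
  proof transfer
    fix x y z :: "real^'a"
    have "dist_int (x - y) \<le> dist_int (x - z) + dist_int (z - y)"
      using dist_int_triangle[of "x - z" "z - y"] by simp
    then show "dist_int (x - y) \<le> dist_int (x - z) + dist_int (y - z)"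
      using dist_int_uminus[of "y - z"] by simp
  qed
qed (simp_all add: uniformity_torus_def open_torus_def)

end

lemma dist_torus_of: "dist (torus_of x) (torus_of y) = dist_int (x - y)"
  by (rule dist_torus.abs_eq)

text \<open>
  The \<open>s\<close>-th power of the diameter, with the convention that it is \<open>0\<close> for the empty set and that
  \<open>0 ^ 0 = 1\<close> otherwise (whereas \<open>0 powr 0 = 0\<close>).
\<close>
definition diam_power :: "real \<Rightarrow> 'a::metric_space set \<Rightarrow> ennreal" where
  "diam_power s U =
     (if U = {} then 0 else if s = 0 then 1 else ennreal (diameter U powr s))"

text \<open>Boundedness is required explicitly since \<^const>\<open>diameter\<close> is meaningless for unbounded sets.\<close>
definition hausdorff_content :: "real \<Rightarrow> real \<Rightarrow> 'a::metric_space set \<Rightarrow> ennreal" where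
  "hausdorff_content s \<delta> E =
     (INF U\<in>{U :: nat \<Rightarrow> 'a set.
               E \<subseteq> (\<Union>i. U i) \<and> (\<forall>i. bounded (U i) \<and> diameter (U i) \<le> \<delta>)}.
        \<Sum>i. diam_power s (U i))"

definition hausdorff_measure :: "real \<Rightarrow> 'a::metric_space set \<Rightarrow> ennreal" where
  "hausdorff_measure s E = (SUP \<delta>\<in>{0<..}. hausdorff_content s \<delta> E)"

definition hausdorff_dim :: "'a::metric_space set \<Rightarrow> ereal" where
  "hausdorff_dim E = (INF s\<in>{s. 0 \<le> s \<and> hausdorff_measure s E = 0}. ereal s)"

text \<open>
  By \<open>dist_torus_of\<close>, the distance below is \<open>\<bar>A q - b\<bar>\<close> modulo \<open>\<int>\<^sup>m\<close>.
  Only the values of \<open>\<psi>\<close> on positive reals matter, as \<open>q \<noteq> 0\<close>.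
\<close>
definition W :: "real^'n^'m \<Rightarrow> (real \<Rightarrow> real) \<Rightarrow> 'm torus set" where
  "W A \<psi> =
     {b. infinite {q \<in> int_vecs. q \<noteq> 0 \<and> dist (torus_of (A *v q)) b < \<psi> (infnorm q)}}"

definition singular_matrix :: "real^'n^'m \<Rightarrow> bool" where
  "singular_matrix A \<longleftrightarrow>
     (\<forall>\<epsilon>>0. \<forall>\<^sub>F Q in at_top. \<exists>q\<in>int_vecs. 0 < infnorm q \<and> infnorm q \<le> Q \<and>
        dist_int (A *v q) < \<epsilon> * Q powr (- real CARD('n) / real CARD('m)))"

definition u_mat :: "real^'n^'m \<Rightarrow> real^('m + 'n)^('m + 'n)" where
  "u_mat A = (\<chi> i j. case (i, j) of
       (Inl a, Inr b) \<Rightarrow> A $ a $ b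
     | _ \<Rightarrow> (if i = j then 1 else 0))"

definition a_mat :: "real \<Rightarrow> real^('m::finite + 'n::finite)^('m + 'n)" where
  "a_mat t = (\<chi> i j. if i = j
     then (case i of Inl _ \<Rightarrow> exp (t / real CARD('m)) | Inr _ \<Rightarrow> exp (- t / real CARD('n)))
     else 0)"

definition lattice_of :: "real^'n^'m \<Rightarrow> (real^('m + 'n)) set" where
  "lattice_of A = (\<lambda>x. u_mat A *v x) ` int_vecs"

definition successive_min :: "nat \<Rightarrow> (real^'k) set \<Rightarrow> real" where
  "successive_min i L =
     Inf {\<rho>. \<rho> > 0 \<and> (\<exists>S \<subseteq> L \<inter> {x. \<forall>j. \<bar>x $ j\<bar> \<le> \<rho>}. independent S \<and> card S = i)}"

definition Delta :: "nat \<Rightarrow> real^'n^'m \<Rightarrow> real" where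
  "Delta k A = (\<Prod>i = 1..CARD('m) + CARD('n).
     min 1 (successive_min i
       ((\<lambda>x. a_mat (real CARD('n) * real k * ln 2) *v x) ` lattice_of A)))"

end

theory Submission
  imports Defs
begin

text \<open>
  The upper bound is the covering of \<open>W\<close> by the balls around the points \<open>A q\<close>.

  For the lower bound, both hypotheses give \<open>\<Delta>\<^sub>k \<ge> 2 powr (- e k)\<close> for infinitely many \<open>k\<close>, for every \<open>e > 0\<close>.
  By Minkowski's second theorem the last successive minimum is then at most a constant times
  \<open>2 powr (e k)\<close>, so that up to a factor \<open>2 powr (O (e k))\<close> the points \<open>A q\<close> with \<open>\<bar>q\<bar> \<le> 2 ^ k\<close> are
  \<open>2 powr (- k n / m)\<close>-dense in the torus. Hence within a fixed ball one finds, for suitable large \<open>k\<close>,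
  an essentially regular grid of such points. Given a cover of \<open>W\<close> of small total \<open>s\<close>-mass,
  where \<open>s < min m (n / v)\<close>, an averaging argument over this grid selects a much smaller ball, centred at some
  \<open>A q\<close> and of radius less than \<open>\<bar>q\<bar> powr (- v)\<close>, which again meets only little of the cover. Iterating, one
  reaches a point of \<open>W\<close> outside the cover. No measure on a Cantor set is needed.
\<close>

subsection \<open>Minkowski's second theorem\<close>

text \<open>Why \<open>n / v\<close> is the threshold: if the points \<open>A q\<close> with
  \<open>|q| \<le> Q\<close> are \<open>r\<close>-dense, a ball of radius \<open>\<rho>\<close>
  contains about \<open>(\<rho> / r) ^ m\<close> well separated ones, while shrinking the radius to
  \<open>\<rho>'\<close> lowers the admissible mass by the factor
  \<open>(\<rho> / \<rho>') powr s\<close>. With \<open>r\<close> about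
  \<open>2 powr (- k n / m)\<close>, \<open>Q\<close> about \<open>2 ^ k\<close> and
  \<open>\<rho>'\<close> about \<open>Q powr (- v)\<close>, this compares
  \<open>2 powr (k n)\<close> with \<open>2 powr (k v s)\<close>; for \<open>s < n / v\<close> the
  surplus exponent absorbs both the losses \<open>2 powr (O (e k))\<close> and all constants
  depending on \<open>\<rho>\<close>. The condition \<open>s \<le> m\<close> serves the cover sets
  whose size lies between \<open>r\<close> and \<open>\<rho>\<close>. The obstacle is that good
  \<open>k\<close> are merely frequent, with no control over the gaps between them. Each stage
  therefore waits for a good \<open>k\<close> that is large relative to the ball already reached,
  and cover sets of every size in between are handled by counting alone. The balls around distinct
  grid approximations stay small compared with the mesh only if \<open>\<rho>' \<le> r\<close>,
  which calls for \<open>v \<ge> n / m\<close>. Smaller \<open>v\<close> are compared with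
  \<open>n / m\<close>, where the dimension is already \<open>m\<close>.\<close>

text \<open>
  The library's \<open>measure_linear_image\<close> requires a well-ordered index type, which \<open>'m + 'n\<close> is not.
\<close>
lemma measure_linear_image_cart:
  fixes f :: "real^'n \<Rightarrow> real^'n"
  assumes "linear f" "S \<in> lmeasurable"
  shows "f ` S \<in> lmeasurable \<and> measure lebesgue (f ` S) = \<bar>det (matrix f)\<bar> * measure lebesgue S"
proof -
  define scales :: "(real^'n \<Rightarrow> real^'n) \<Rightarrow> bool" where
    "scales f \<longleftrightarrow> (\<forall>S\<in>lmeasurable. f ` S \<in> lmeasurable \<and>
        measure lebesgue (f ` S) = \<bar>det (matrix f)\<bar> * measure lebesgue S)" for f
  have boxes: "scales f"
    if "linear f" "\<bar>det (matrix f)\<bar> = 1"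
      "\<And>a b. cbox a b \<noteq> {} \<Longrightarrow> measure lebesgue (f ` cbox a b) = measure lebesgue (cbox a b)" for f
    unfolding scales_def
  proof
    fix S :: "(real^'n) set" assume "S \<in> lmeasurable"
    moreover have "measure lebesgue (f ` cbox a b) = 1 * measure lebesgue (cbox a b)" for a b
      using that(3)[of a b] by (cases "cbox a b = {}") auto
    ultimately have "f ` S \<in> lmeasurable \<and> 1 * measure lebesgue S = measure lebesgue (f ` S)"
      by (rule measure_linear_sufficient[OF that(1)])
    then show "f ` S \<in> lmeasurable \<and> measure lebesgue (f ` S) = \<bar>det (matrix f)\<bar> * measure lebesgue S"
      using that(2) by simp
  qed
  have "scales f"
    using assms(1)
  proof (rule induct_linear_elementary)
    show "scales (f \<circ> g)" if "linear f" "linear g" "scales f" "scales g" for f g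
    proof -
      have "(f \<circ> g) ` S = f ` g ` S" for S by (simp add: image_comp)
      then show ?thesis
        using that(3,4) matrix_compose[OF that(2,1)] unfolding scales_def
        by (simp only: det_mul abs_mult) simp
    qed
  next
    fix f :: "real^'n \<Rightarrow> real^'n" and i
    assume "linear f" and zero: "\<And>x. f x $ i = 0"
    have "det (matrix f) = 0"
      by (rule det_zero_row(1)[of i]) (simp add: row_def matrix_def zero vec_eq_iff)
    moreover have "negligible (f ` S)" for S
      by (rule negligible_subset[OF negligible_standard_hyperplane_cart[of i]]) (auto simp: zero)
    ultimately show "scales f"
      by (simp add: scales_def negligible_iff_measure)
  next
    show "scales (\<lambda>x. \<chi> i. c i * x $ i)" for c
      by (simp add: scales_def measurable_stretch measure_stretch matrix_def axis_def det_diagonal)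
  next
    fix m n :: 'n assume "m \<noteq> n"
    let ?t = "Transposition.transpose m n"
    let ?h = "\<lambda>x::real^'n. \<chi> i. x $ ?t i"
    have lin: "linear ?h" by (rule linearI) (simp_all add: vec_eq_iff)
    show "scales ?h"
    proof (rule boxes[OF lin])
      have "matrix ?h = (\<chi> i. (mat 1 :: real^'n^'n) $ ?t i)"
        by (simp add: matrix_def mat_def axis_def vec_eq_iff)
      then show "\<bar>det (matrix ?h)\<bar> = 1"
        by (simp add: det_permute_rows permutes_swap_id sign_swap_id)
      fix a b :: "real^'n" assume ne: "cbox a b \<noteq> {}"
      have "?h ` cbox a b = cbox (?h a) (?h b)"
      proof (intro equalityI subsetI)
        fix x assume "x \<in> cbox (?h a) (?h b)"
        then have "?h x \<in> cbox a b"
          by (simp add: mem_box_cart) (metis transpose_involutory)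
        moreover have "x = ?h (?h x)" by (simp add: vec_eq_iff)
        ultimately show "x \<in> ?h ` cbox a b" by blast
      qed (auto simp: mem_box_cart)
      moreover have "(\<Prod>i\<in>UNIV. b $ ?t i - a $ ?t i) = (\<Prod>i\<in>UNIV. b $ i - a $ i)"
        using prod.reindex_bij_betw[OF permutes_imp_bij[OF permutes_swap_id[of m UNIV n]],
            of "\<lambda>i. b $ i - a $ i"] by simp
      moreover have "cbox (?h a) (?h b) \<noteq> {}"
        using ne calculation(1) by blast
      ultimately show "measure lebesgue (?h ` cbox a b) = measure lebesgue (cbox a b)"
        using ne by (simp add: content_cbox_cart)
    qed
  next
    fix m n :: 'n assume mn: "m \<noteq> n"
    let ?h = "\<lambda>x::real^'n. \<chi> i. if i = m then x $ m + x $ n else x $ i"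
    have lin: "linear ?h"
      by (rule linearI) (simp_all add: vec_eq_iff algebra_simps)
    show "scales ?h"
    proof (rule boxes[OF lin])
      have "matrix ?h = (\<chi> k. if k = m then row m (mat 1) + 1 *s row n (mat 1) else row k (mat 1 :: real^'n^'n))"
        by (auto simp: matrix_def mat_def axis_def row_def vec_eq_iff)
      then show "\<bar>det (matrix ?h)\<bar> = 1"
        using det_row_operation[OF mn, of "mat 1 :: real^'n^'n" 1] by simp
      fix a b :: "real^'n" assume ne: "cbox a b \<noteq> {}"
      \<comment> \<open>\<open>measure_shear_interval\<close> asks for a nonnegative lower corner in
        coordinate \<open>n\<close>; the translation by \<open>z\<close> moves that coordinate to
        0.\<close>
      define z where "z = axis n (a $ n)"
      have box: "cbox a b = (+) z ` cbox (a - z) (b - z)"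
        by (simp flip: cbox_translation)
      have "?h ` cbox a b = (+) (?h z) ` ?h ` cbox (a - z) (b - z)"
        unfolding box image_image using linear_add[OF lin] by simp
      then have "measure lebesgue (?h ` cbox a b) = measure lebesgue (?h ` cbox (a - z) (b - z))"
        by (simp only: measure_translation)
      also have "\<dots> = measure lebesgue (cbox (a - z) (b - z))"
      proof (rule measure_shear_interval[OF mn])
        show "cbox (a - z) (b - z) \<noteq> {}" using ne box by blast
        show "0 \<le> (a - z) $ n" by (simp add: z_def)
      qed
      also have "\<dots> = measure lebesgue (cbox a b)"
        unfolding box by (simp only: measure_translation)
      finally show "measure lebesgue (?h ` cbox a b) = measure lebesgue (cbox a b)" .
    qed
  qed
  with assms(2) show ?thesis by (simp add: scales_def)
qed

text \<open>Cut \<open>S\<close> along the integer translates of a unit cube and move all pieces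
  into that cube. Points of \<open>S\<close> are distinct modulo integer vectors, so the moved
  pieces are disjoint and their total measure is at most that of the cube.\<close>

lemma blichfeldt:
  fixes S :: "(real^'k) set"
  assumes S: "S \<in> lmeasurable" and "bounded S"
    and inj: "\<And>x y. x \<in> S \<Longrightarrow> y \<in> S \<Longrightarrow> x - y \<in> int_vecs \<Longrightarrow> x = y"
  shows "measure lebesgue S \<le> 1"
proof -
  define fl :: "real^'k \<Rightarrow> real^'k" where "fl x = (\<chi> i. of_int \<lfloor>x $ i\<rfloor>)" for x
  \<comment> \<open>Half-open, so that every point lies in exactly one integer translate of
    \<open>D\<close>.\<close>
  define D :: "(real^'k) set" where "D = {x. \<forall>i. 0 \<le> x $ i \<and> x $ i < 1}"
  have fl_int: "fl x \<in> int_vecs" for x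
    by (simp add: fl_def int_vecs_def)
  have in_D: "x - fl x \<in> D" for x
    by (auto simp: fl_def D_def) linarith
  have D_meas: "D \<in> lmeasurable"
  proof (rule bounded_set_imp_lmeasurable)
    have "D \<subseteq> cbox 0 1" by (auto simp: D_def mem_box_cart less_imp_le)
    then show "bounded D" by (rule bounded_subset[OF bounded_cbox])
    have "D = (\<Inter>i. {x. 0 \<le> x $ i}) \<inter> (\<Inter>i. {x. x $ i < 1})" by (auto simp: D_def)
    also have "\<dots> \<in> sets borel"
      by (intro sets.Int sets.finite_INT borel_closed borel_open
          closed_halfspace_component_ge_cart open_halfspace_component_lt_cart
          closed_Collect_le open_Collect_less continuous_intros) auto
    finally show "D \<in> sets lebesgue" by simp
  qed
  define F where "F = fl ` S"
  have "finite F"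
  proof -
    obtain B where B: "\<And>x i. x \<in> S \<Longrightarrow> \<bar>x $ i\<bar> \<le> B"
      using \<open>bounded S\<close> unfolding bounded_iff by (meson component_le_norm_cart order_trans)
    have "F \<subseteq> (\<lambda>f. (\<chi> i. of_int (f i))) ` (Pi\<^sub>E UNIV (\<lambda>i::'k. {\<lfloor>-B\<rfloor>..\<lfloor>B\<rfloor>}))"
    proof
      fix z assume "z \<in> F"
      then obtain x where x: "x \<in> S" "z = fl x" by (auto simp: F_def)
      have "(\<lambda>i. \<lfloor>x $ i\<rfloor>) \<in> (Pi\<^sub>E UNIV (\<lambda>i::'k. {\<lfloor>-B\<rfloor>..\<lfloor>B\<rfloor>}))"
        using B[OF x(1)] by (auto intro!: floor_mono simp: abs_le_iff minus_le_iff)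
      then show "z \<in> (\<lambda>f. (\<chi> i. of_int (f i))) ` (Pi\<^sub>E UNIV (\<lambda>i::'k. {\<lfloor>-B\<rfloor>..\<lfloor>B\<rfloor>}))"
        using x by (auto simp: fl_def)
    qed
    then show ?thesis
      by (rule finite_subset) (intro finite_imageI finite_PiE, auto)
  qed
  define P where "P z = {x \<in> S. x - z \<in> D}" for z
  have fl_unique: "z = fl x" if "z \<in> int_vecs" "x - z \<in> D" for x z
  proof -
    have "z $ i = fl x $ i" for i
    proof -
      have "z $ i \<in> \<int>" using that(1) by (simp add: int_vecs_def)
      then obtain k where k: "z $ i = of_int k" by (rule Ints_cases)
      have "0 \<le> x $ i - z $ i" "x $ i - z $ i < 1" using that(2) by (auto simp: D_def)
      then have "\<lfloor>x $ i\<rfloor> = k" unfolding k by linarith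
      then show ?thesis by (simp add: fl_def k)
    qed
    then show ?thesis by (simp add: vec_eq_iff)
  qed
  have P_eq: "P z = S \<inter> (+) z ` D" for z
  proof -
    have "x \<in> (+) z ` D \<longleftrightarrow> x - z \<in> D" for x
      using image_eqI[of x "(+) z" "x - z" D] by auto
    then show ?thesis by (auto simp: P_def)
  qed
  have P_meas: "P z \<in> lmeasurable" for z
    unfolding P_eq by (intro fmeasurable.Int S measurable_translation D_meas)
  define T where "T z = (\<lambda>x. x - z) ` P z" for z
  have T_meas: "T z \<in> lmeasurable" for z
    unfolding T_def by (intro measurable_translation_subtract P_meas)
  have T_measure: "measure lebesgue (T z) = measure lebesgue (P z)" for z
    unfolding T_def by (rule measure_translation_subtract)
  have "S = (\<Union>z\<in>F. P z)"
    using in_D by (auto simp: P_def F_def)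
  also have "measure lebesgue \<dots> = (\<Sum>z\<in>F. measure lebesgue (P z))"
  proof (rule measure_UNION'[OF \<open>finite F\<close> P_meas])
    show "pairwise (\<lambda>z w. disjnt (P z) (P w)) F"
    proof (rule pairwiseI)
      fix z w assume zw: "z \<in> F" "w \<in> F" "z \<noteq> w"
      have "z = fl x" "w = fl x" if "x \<in> P z" "x \<in> P w" for x
        using that zw(1,2) fl_int fl_unique[of z x] fl_unique[of w x] by (auto simp: F_def P_def)
      then show "disjnt (P z) (P w)" using zw(3) unfolding disjnt_iff by metis
    qed
  qed
  also have "\<dots> = (\<Sum>z\<in>F. measure lebesgue (T z))"
    by (simp add: T_measure)
  also have "\<dots> = measure lebesgue (\<Union>z\<in>F. T z)"
  proof (rule measure_UNION'[OF \<open>finite F\<close> T_meas, symmetric])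
    have "z = w" if "z \<in> F" "w \<in> F" "x \<in> P z" "y \<in> P w" "x - z = y - w" for x y z w
    proof -
      have "x - y = z - w" using that(5) by (simp add: algebra_simps)
      moreover have "z - w \<in> int_vecs"
        using that fl_int by (auto simp: F_def intro!: int_vecs_diff)
      ultimately have "x = y" using inj that by (auto simp: P_def)
      then show ?thesis using that(5) by simp
    qed
    then show "pairwise (\<lambda>z w. disjnt (T z) (T w)) F"
      by (intro pairwiseI) (auto simp: disjnt_iff T_def)
  qed
  also have "\<dots> \<le> measure lebesgue (cbox 0 (1::real^'k))"
  proof (rule measure_mono_fmeasurable)
    show "(\<Union>z\<in>F. T z) \<subseteq> cbox 0 1"
      by (auto simp: T_def P_def D_def mem_box_cart less_imp_le)
    show "(\<Union>z\<in>F. T z) \<in> sets lebesgue"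
      using \<open>finite F\<close> T_meas by (intro sets.finite_UN) (auto intro: fmeasurableD)
  qed auto
  also have "\<dots> = 1"
  proof -
    have "0 \<in> cbox 0 (1::real^'k)" by (simp add: mem_box_cart)
    then have "cbox 0 (1::real^'k) \<noteq> {}" by blast
    then show ?thesis by (simp add: content_cbox_cart)
  qed
  finally show ?thesis .
qed

text \<open>The vectors are chosen from the highest index downwards: \<open>e j\<close> must be
  orthogonal to \<open>V j\<close> and to the \<open>DIM('a) - Suc j\<close> vectors already chosen,
  and these span together at most \<open>DIM('a) - 1\<close> dimensions.\<close>

lemma orthonormal_descending:
  fixes V :: "nat \<Rightarrow> 'a::euclidean_space set"
  assumes "\<And>j. j < DIM('a) \<Longrightarrow> dim (V j) \<le> j"
  obtains e where "\<And>j. j < DIM('a) \<Longrightarrow> norm (e j) = 1"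
    and "\<And>i j. i < DIM('a) \<Longrightarrow> j < DIM('a) \<Longrightarrow> i \<noteq> j \<Longrightarrow> orthogonal (e i) (e j)"
    and "\<And>j x. j < DIM('a) \<Longrightarrow> x \<in> V j \<Longrightarrow> orthogonal (e j) x"
proof -
  let ?d = "DIM('a)"
  have "\<exists>e. (\<forall>j<?d. n \<le> j \<longrightarrow> norm (e j) = 1 \<and> (\<forall>x\<in>V j. orthogonal (e j) x)) \<and>
            (\<forall>i<?d. \<forall>j<?d. n \<le> i \<longrightarrow> n \<le> j \<longrightarrow> i \<noteq> j \<longrightarrow> orthogonal (e i) (e j))"
    if "n \<le> ?d" for n
    using that
  proof (induction n rule: inc_induct)
    case base
    then show ?case by auto
  next
    case (step n)
    then obtain e where
      e: "\<And>j. j < ?d \<Longrightarrow> Suc n \<le> j \<Longrightarrow> norm (e j) = 1 \<and> (\<forall>x\<in>V j. orthogonal (e j) x)"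
         "\<And>i j. i < ?d \<Longrightarrow> j < ?d \<Longrightarrow> Suc n \<le> i \<Longrightarrow> Suc n \<le> j \<Longrightarrow> i \<noteq> j \<Longrightarrow> orthogonal (e i) (e j)"
      by blast
    have "dim (V n \<union> e ` {Suc n..<?d}) \<le> dim (V n) + dim (e ` {Suc n..<?d})"
    proof -
      have "dim (V n \<union> e ` {Suc n..<?d}) = dim (span (V n \<union> e ` {Suc n..<?d}))" by simp
      also have "\<dots> = dim {x + y |x y. x \<in> span (V n) \<and> y \<in> span (e ` {Suc n..<?d})}"
        by (simp only: span_Un)
      also have "\<dots> \<le> dim (V n) + dim (e ` {Suc n..<?d})"
        using dim_sums_Int[of "span (V n)" "span (e ` {Suc n..<?d})"] by simp
      finally show ?thesis .
    qed
    also have "dim (e ` {Suc n..<?d}) \<le> card (e ` {Suc n..<?d})"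
      by (rule dim_le_card') simp
    also have "\<dots> \<le> ?d - Suc n"
      using card_image_le[of "{Suc n..<?d}" e] by simp
    finally have "dim (V n \<union> e ` {Suc n..<?d}) < ?d"
      using assms[of n] step.hyps by linarith
    then obtain y where y: "y \<noteq> 0" "\<And>x. x \<in> span (V n \<union> e ` {Suc n..<?d}) \<Longrightarrow> orthogonal y x"
      using orthogonal_to_subspace_exists by blast
    define f where "f = e(n := y /\<^sub>R norm y)"
    have fn: "norm (f n) = 1" using y(1) by (simp add: f_def)
    have orth: "orthogonal (f n) x" if "x \<in> V n \<union> e ` {Suc n..<?d}" for x
      using y(2)[OF span_base[OF that]] by (simp add: f_def orthogonal_clauses)
    have feq: "f j = e j" if "Suc n \<le> j" for j using that by (simp add: f_def)
    show ?case
    proof (intro exI[of _ f] conjI allI impI)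
      fix j assume "j < ?d" "n \<le> j"
      then show "norm (f j) = 1" using fn e(1)[of j] feq[of j] by (cases "j = n") auto
      show "\<forall>x\<in>V j. orthogonal (f j) x"
        using orth e(1)[of j] feq[of j] \<open>j < ?d\<close> \<open>n \<le> j\<close> by (cases "j = n") auto
    next
      fix i j assume ij: "i < ?d" "j < ?d" "n \<le> i" "n \<le> j" "i \<noteq> j"
      consider "i = n" "Suc n \<le> j" | "j = n" "Suc n \<le> i" | "Suc n \<le> i" "Suc n \<le> j"
        using ij by linarith
      then show "orthogonal (f i) (f j)"
        by cases (use ij e(2) feq orth in \<open>auto simp: orthogonal_commute\<close>)
    qed
  qed
  from this[of 0] that show ?thesis by simp metis
qed

section \<open>Successive minima\<close>

lemma infnorm_le_cart:
  fixes x :: "real^'k"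
  assumes "\<And>i. \<bar>x $ i\<bar> \<le> b"
  shows "infnorm x \<le> b"
  unfolding infnorm_cart using assms by (intro cSup_least) auto

lemma successive_min_le:
  assumes "S \<subseteq> L" "independent S" "card S = i" "0 < \<rho>" "\<And>x. x \<in> S \<Longrightarrow> infnorm x \<le> \<rho>"
  shows "successive_min i L \<le> \<rho>"
  unfolding successive_min_def
proof (rule cInf_lower)
  have "S \<subseteq> L \<inter> {x. \<forall>j. \<bar>x $ j\<bar> \<le> \<rho>}"
    using assms(1,5) component_le_infnorm_cart order_trans by blast
  then show "\<rho> \<in> {\<rho>. 0 < \<rho> \<and>
      (\<exists>S\<subseteq>L \<inter> {x. \<forall>j. \<bar>x $ j\<bar> \<le> \<rho>}. independent S \<and> card S = i)}"
    using assms(2-4) by blast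
qed (auto intro!: bdd_belowI[of _ 0])

text \<open>\<open>Inf\<close> of an empty set of reals carries no information, so facts that need
  lattice vectors close to a minimum must first know that enough independent vectors exist. The set
  \<open>B\<close> supplies them.\<close>

lemma successive_min_witness:
  fixes L :: "(real^'k) set"
  assumes "B \<subseteq> L" "independent B" "i \<le> card B"
  shows "\<exists>\<rho>>0::real. \<exists>S\<subseteq>L \<inter> {x. \<forall>j. \<bar>x $ j\<bar> \<le> \<rho>}. independent S \<and> card S = i"
proof -
  have "finite B" using assms(2) by (rule finiteI_independent)
  obtain S where S: "S \<subseteq> B" "card S = i"
    using obtain_subset_with_card_n[OF assms(3)] by blast
  define \<rho> where "\<rho> = 1 + (\<Sum>x\<in>B. infnorm x)"
  have "\<bar>x $ j\<bar> \<le> \<rho>" if "x \<in> S" for x j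
  proof -
    have "\<bar>x $ j\<bar> \<le> infnorm x" by (rule component_le_infnorm_cart)
    also have "\<dots> \<le> (\<Sum>x\<in>B. infnorm x)"
      using S that by (intro member_le_sum infnorm_pos_le \<open>finite B\<close>) auto
    finally show ?thesis by (simp add: \<rho>_def)
  qed
  moreover have "0 < \<rho>"
    unfolding \<rho>_def by (intro add_pos_nonneg sum_nonneg infnorm_pos_le) auto
  moreover have "independent S" using assms(2) S(1) by (rule independent_mono)
  ultimately show ?thesis using S assms(1) by (intro exI[of _ \<rho>] conjI exI[of _ S]) auto
qed

lemma successive_min_less_obtain:
  assumes "B \<subseteq> L" "independent B" "i \<le> card B" "successive_min i L < \<rho>"
  obtains S where "S \<subseteq> L" "independent S" "card S = i" "\<And>x j. x \<in> S \<Longrightarrow> \<bar>x $ j\<bar> \<le> \<rho>"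
proof -
  let ?R = "{\<rho>. 0 < \<rho> \<and> (\<exists>S\<subseteq>L \<inter> {x. \<forall>j. \<bar>x $ j\<bar> \<le> \<rho>}. independent S \<and> card S = i)}"
  have "?R \<noteq> {}" using successive_min_witness[OF assms(1-3)] by blast
  with assms(4) obtain \<sigma> where "\<sigma> \<in> ?R" "\<sigma> < \<rho>"
    unfolding successive_min_def by (meson cInf_lessD)
  then obtain S where "S \<subseteq> L" "\<forall>x\<in>S. \<forall>j. \<bar>x $ j\<bar> \<le> \<sigma>" "independent S" "card S = i"
    by blast
  with \<open>\<sigma> < \<rho>\<close> show ?thesis by (intro that[of S]) (auto intro: order_trans[OF _ less_imp_le])
qed

lemma successive_min_nonneg:
  assumes "B \<subseteq> L" "independent B" "i \<le> card B"
  shows "0 \<le> successive_min i L"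
  unfolding successive_min_def
  using successive_min_witness[OF assms] by (intro cInf_greatest) auto

lemma successive_min_mono:
  assumes "B \<subseteq> L" "independent B" "j \<le> card B" "i \<le> j"
  shows "successive_min i L \<le> successive_min j L"
proof (rule dense_ge)
  fix \<rho> assume "successive_min j L < \<rho>"
  obtain S where S: "S \<subseteq> L" "independent S" "card S = j" "\<And>x i. x \<in> S \<Longrightarrow> \<bar>x $ i\<bar> \<le> \<rho>"
    by (rule successive_min_less_obtain[OF assms(1-3) \<open>successive_min j L < \<rho>\<close>]) (rule that)
  obtain T where T: "T \<subseteq> S" "card T = i"
    using obtain_subset_with_card_n[of i S] S(3) assms(4) by blast
  show "successive_min i L \<le> \<rho>"
  proof (rule successive_min_le)
    show "T \<subseteq> L" using S(1) T(1) by (rule subset_trans[rotated])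
    show "independent T" using S(2) T(1) by (rule independent_mono)
    show "card T = i" by (rule T(2))
    show "0 < \<rho>"
      using successive_min_nonneg[OF assms(1-3)] \<open>successive_min j L < \<rho>\<close> by (rule le_less_trans)
    show "infnorm x \<le> \<rho>" if "x \<in> T" for x
      using subsetD[OF T(1) that] by (intro infnorm_le_cart S(4))
  qed
qed

text \<open>Otherwise there are \<open>Suc j\<close> independent vectors of this kind, and the
  largest of their finitely many norms is an admissible radius strictly below the infimum.\<close>

lemma dim_below_successive_min:
  fixes L :: "(real^'k) set"
  shows "dim {x \<in> L. infnorm x < successive_min (Suc j) L} \<le> j"
proof (rule ccontr)
  assume less: "\<not> ?thesis"
  obtain B where B: "B \<subseteq> {x \<in> L. infnorm x < successive_min (Suc j) L}" "independent B"
    "card B = dim {x \<in> L. infnorm x < successive_min (Suc j) L}"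
    by (rule basis_exists[of "{x \<in> L. infnorm x < successive_min (Suc j) L}"]) (rule that)
  have "Suc j \<le> card B" using less B(3) by linarith
  then obtain S where S: "S \<subseteq> B" "card S = Suc j"
    by (rule obtain_subset_with_card_n)
  have indep: "independent S" using B(2) S(1) by (rule independent_mono)
  have "finite S" "S \<noteq> {}" using S by (auto intro: card_ge_0_finite)
  define \<rho> where "\<rho> = Max (infnorm ` S)"
  have "\<rho> \<in> infnorm ` S"
    unfolding \<rho>_def using \<open>finite S\<close> \<open>S \<noteq> {}\<close> by (intro Max_in) auto
  then obtain x where x: "x \<in> S" "\<rho> = infnorm x" by blast
  have "x \<noteq> 0" using x(1) indep dependent_zero by blast
  then have "0 < \<rho>" using x(2) by (simp add: infnorm_pos_lt)
  have "successive_min (Suc j) L \<le> \<rho>"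
    using S(1,2) B(1) indep \<open>0 < \<rho>\<close> \<open>finite S\<close>
    by (intro successive_min_le[of S] Max_ge) (auto simp: \<rho>_def)
  also have "\<rho> < successive_min (Suc j) L" using x S(1) B(1) by auto
  finally show False by simp
qed

lemma lattice_full_rank:
  fixes g :: "real^'k^'k"
  assumes "det g \<noteq> 0"
  obtains B where "B \<subseteq> (\<lambda>x. g *v x) ` int_vecs" "independent B" "card B = CARD('k)"
proof
  have inj: "inj (\<lambda>x. g *v x)"
    using assms by (intro inj_matrix_vector_mult) (simp add: invertible_det_nz)
  have lin: "linear (\<lambda>x. g *v x)" by simp
  let ?B = "(\<lambda>x. g *v x) ` (Basis :: (real^'k) set)"
  show "?B \<subseteq> (\<lambda>x. g *v x) ` int_vecs"
    by (auto simp: int_vecs_def Basis_vec_def axis_def)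
  show "independent ?B"
    using lin independent_Basis inj_on_subset[OF inj subset_UNIV]
    by (rule linear_independent_injective_image)
  show "card ?B = CARD('k)"
    using inj by (simp add: card_image inj_on_subset)
qed

text \<open>
  The constant is not optimal. Choose an orthonormal basis \<open>e\<^sub>j\<close> with
  \<open>e\<^sub>j\<close> orthogonal to all lattice vectors shorter than \<open>\<lambda>\<^sub>j\<^sub>+\<^sub>1\<close>. The box with half-sides
  \<open>\<lambda>\<^sub>j\<^sub>+\<^sub>1 / (4 d)\<close> in this basis has no two points differing by a nonzero lattice vector \<open>w\<close>: if \<open>e\<^sub>i\<close> is the
  last basis vector occurring in \<open>w\<close>, then \<open>w\<close> is not orthogonal to \<open>e\<^sub>i\<close>, yet it is shorter than \<open>\<lambda>\<^sub>i\<^sub>+\<^sub>1\<close>.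
\<close>
theorem minkowski_second:
  fixes g :: "real^'k^'k"
  defines "L \<equiv> (\<lambda>x. g *v x) ` int_vecs"
  assumes det: "\<bar>det g\<bar> = 1"
  shows "(\<Prod>i = 1..CARD('k). successive_min i L) \<le> (2 * real CARD('k)) ^ CARD('k)"
proof -
  let ?d = "CARD('k)"
  \<comment> \<open>Indexed from 0, so that the vectors shorter than \<open>lam j\<close> have
    dimension at most \<open>j\<close>, as \<open>orthonormal_descending\<close> demands.\<close>
  define lam where "lam j = successive_min (Suc j) L" for j
  obtain B where B: "B \<subseteq> L" "independent B" "card B = ?d"
    using lattice_full_rank[of g] det unfolding L_def by force
  have lam_nonneg: "0 \<le> lam j" if "j < ?d" for j
    using successive_min_nonneg[OF B(1,2)] that B(3) by (simp add: lam_def)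
  have lam_mono: "lam i \<le> lam j" if "j < ?d" "i \<le> j" for i j
    using successive_min_mono[OF B(1,2)] that B(3) by (simp add: lam_def)
  obtain e :: "nat \<Rightarrow> real^'k" where e: "\<And>j. j < ?d \<Longrightarrow> norm (e j) = 1"
      "\<And>i j. i < ?d \<Longrightarrow> j < ?d \<Longrightarrow> i \<noteq> j \<Longrightarrow> orthogonal (e i) (e j)"
      "\<And>j x. j < ?d \<Longrightarrow> x \<in> {x \<in> L. infnorm x < lam j} \<Longrightarrow> orthogonal (e j) x"
  proof (rule orthonormal_descending[where V = "\<lambda>j. {x \<in> L. infnorm x < lam j}"])
    show "dim {x \<in> L. infnorm x < lam j} \<le> j" for j
      unfolding lam_def by (rule dim_below_successive_min)
  qed (rule that, simp_all)
  \<comment> \<open>The numbering \<open>h\<close> gives the coordinates an order, in which a last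
    nonzero coordinate can be chosen.\<close>
  obtain h :: "'k \<Rightarrow> nat" where h: "bij_betw h UNIV {0..<?d}"
    using ex_bij_betw_finite_nat[of "UNIV :: 'k set"] by auto
  have h_less: "h c < ?d" for c using h by (auto simp: bij_betw_def)
  have h_inj: "h c = h c' \<Longrightarrow> c = c'" for c c' using h by (auto simp: bij_betw_def inj_def)
  define R :: "real^'k^'k" where "R = (\<chi> r c. e (h c) $ r)"
  have col: "column c R = e (h c)" for c
    by (simp add: column_def R_def)
  have R: "orthogonal_matrix R"
    unfolding orthogonal_matrix_orthonormal_columns col
    using e(1,2) h_less h_inj by metis
  \<comment> \<open>With these half-sides two points of the box differ by at most
    \<open>lam j / (2 d)\<close> along \<open>e j\<close>; \<open>d\<close> such contributions with
    \<open>lam j\<close> at most \<open>lam i\<close> add up to at most half of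
    \<open>lam i\<close>, contradicting a length of at least \<open>lam i\<close>.\<close>
  define a :: "real^'k" where "a = (\<chi> c. lam (h c) / (4 * ?d))"
  have a_nonneg: "0 \<le> a $ c" for c using lam_nonneg h_less by (simp add: a_def)
  have "invertible g" using det by (auto simp: invertible_det_nz)
  then obtain g' where gg': "g ** g' = mat 1"
    unfolding invertible_right_inverse by blast
  have "\<bar>det g'\<bar> = 1"
    using arg_cong[OF gg', of "\<lambda>M. \<bar>det M\<bar>"] det by (simp add: det_mul abs_mult)
  \<comment> \<open>Pulling the rotated box back by \<open>g'\<close>, the inverse of
    \<open>g\<close>, turns the lattice \<open>L\<close> into \<open>int_vecs\<close>, to which
    \<open>blichfeldt\<close> applies; the determinant being \<open>1\<close> or \<open>-1\<close>,
    the volume is unchanged.\<close>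
  define S where "S = (\<lambda>t. (g' ** R) *v t) ` cbox (- a) a"
  have "measure lebesgue S = \<bar>det (g' ** R)\<bar> * measure lebesgue (cbox (- a) a)"
    unfolding S_def using measure_linear_image_cart[of "(*v) (g' ** R)" "cbox (- a) a"] by simp
  also have "\<bar>det (g' ** R)\<bar> = 1"
    using det_orthogonal_matrix[OF R] \<open>\<bar>det g'\<bar> = 1\<close> by (auto simp: det_mul abs_mult)
  also have "measure lebesgue (cbox (- a) a) = (\<Prod>c\<in>UNIV. 2 * a $ c)"
  proof -
    have "0 \<in> cbox (- a) a" using a_nonneg by (simp add: mem_box_cart)
    then have "cbox (- a) a \<noteq> {}" by blast
    then show ?thesis by (simp add: content_cbox_cart)
  qed
  also have "\<dots> = (\<Prod>c\<in>UNIV. lam (h c) / (2 * ?d))"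
    by (simp add: a_def)
  also have "\<dots> = (\<Prod>j\<in>{0..<?d}. lam j / (2 * ?d))"
    using prod.reindex_bij_betw[OF h, of "\<lambda>j. lam j / (2 * ?d)"] by simp
  also have "\<dots> = (\<Prod>i = 1..?d. successive_min i L) / (2 * ?d) ^ ?d"
    by (simp add: prod_dividef lam_def prod.atLeast1_atMost_eq lessThan_atLeast0)
  finally have vol: "measure lebesgue S = (\<Prod>i = 1..?d. successive_min i L) / (2 * ?d) ^ ?d"
    by simp
  have "measure lebesgue S \<le> 1"
  proof (rule blichfeldt)
    show "S \<in> lmeasurable"
      unfolding S_def using measure_linear_image_cart[of "(*v) (g' ** R)" "cbox (- a) a"] by simp
    show "bounded S"
      unfolding S_def by (intro bounded_linear_image bounded_cbox) simp
    fix x y assume "x \<in> S" "y \<in> S" and xy: "x - y \<in> int_vecs"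
    then obtain t u where t: "x = (g' ** R) *v t" "t \<in> cbox (-a) a" and u: "y = (g' ** R) *v u" "u \<in> cbox (-a) a"
      by (auto simp: S_def)
    define \<tau> where "\<tau> = t - u"
    define w where "w = R *v \<tau>"
    have "g *v ((g' ** R) *v z) = R *v z" for z
      by (simp add: matrix_vector_mul_assoc matrix_mul_assoc gg')
    then have "w = g *v (x - y)"
      unfolding t u w_def \<tau>_def by (simp add: matrix_vector_mult_diff_distrib)
    then have "w \<in> L" using xy by (auto simp: L_def)
    have coord: "e (h c) \<bullet> w = \<tau> $ c" for c
    proof -
      have "transpose R *v w = \<tau>"
        using R by (simp add: w_def matrix_vector_mul_assoc orthogonal_matrix)
      moreover have "(transpose R *v w) $ c = e (h c) \<bullet> w"
        by (simp add: matrix_vector_mult_def transpose_def R_def inner_vec_def)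
      ultimately show ?thesis by simp
    qed
    have \<tau>_le: "\<bar>\<tau> $ c\<bar> \<le> lam (h c) / (2 * ?d)" for c
    proof -
      have "- a $ c \<le> t $ c" "t $ c \<le> a $ c" "- a $ c \<le> u $ c" "u $ c \<le> a $ c"
        using t(2) u(2) unfolding mem_box_cart by simp_all
      then have "\<bar>\<tau> $ c\<bar> \<le> 2 * a $ c"
        unfolding \<tau>_def vector_minus_component by linarith
      then show ?thesis by (simp add: a_def)
    qed
    have "\<tau> = 0"
    proof (rule ccontr)
      assume "\<tau> \<noteq> 0"
      then have "{c. \<tau> $ c \<noteq> 0} \<noteq> {}" by (auto simp: vec_eq_iff)
      then have "Max (h ` {c. \<tau> $ c \<noteq> 0}) \<in> h ` {c. \<tau> $ c \<noteq> 0}" by (intro Max_in) auto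
      then obtain i where i: "\<tau> $ i \<noteq> 0" "h i = Max (h ` {c. \<tau> $ c \<noteq> 0})"
        by (metis (mono_tags, lifting) imageE mem_Collect_eq)
      have i_max: "h c \<le> h i" if "\<tau> $ c \<noteq> 0" for c
        unfolding i(2) using that by (intro Max_ge) auto
      have "0 < lam (h i) / (2 * ?d)" using i(1) \<tau>_le[of i] by linarith
      then have pos: "0 < lam (h i)" by (simp add: zero_less_divide_iff)
      have "\<not> orthogonal (e (h i)) w" using coord i(1) by (simp add: orthogonal_def)
      then have "lam (h i) \<le> infnorm w"
        using e(3)[OF h_less[of i], of w] \<open>w \<in> L\<close> by force
      also have "\<dots> \<le> norm w" by (rule infnorm_le_norm)
      also have "w = (\<Sum>c\<in>UNIV. \<tau> $ c *\<^sub>R e (h c))"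
        by (simp add: w_def matrix_mult_sum col scalar_mult_eq_scaleR)
      also have "norm \<dots> \<le> (\<Sum>c\<in>(UNIV :: 'k set). lam (h i) / (2 * ?d))"
      proof (rule sum_norm_le)
        fix c
        show "norm (\<tau> $ c *\<^sub>R e (h c)) \<le> lam (h i) / (2 * ?d)"
        proof (cases "\<tau> $ c = 0")
          case False
          have "norm (\<tau> $ c *\<^sub>R e (h c)) = \<bar>\<tau> $ c\<bar>" using e(1)[OF h_less] by simp
          also have "\<dots> \<le> lam (h c) / (2 * ?d)" by (rule \<tau>_le)
          also have "\<dots> \<le> lam (h i) / (2 * ?d)"
            using lam_mono[OF h_less i_max[OF False]] by (intro divide_right_mono) auto
          finally show ?thesis .
        qed (use pos in simp)
      qed
      also have "\<dots> = lam (h i) / 2" by simp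
      finally show False using pos by simp
    qed
    then show "x = y" using t u by (simp add: \<tau>_def)
  qed
  then show ?thesis
    unfolding vol by (simp add: field_simps)
qed

subsection \<open>Density of the points A q\<close>

text \<open>If the last minimum exceeds 1, its own truncated factor is 1, so the untruncated value
  can take that place; the other truncations only decrease the product, and Minkowski's second
  theorem bounds what results. If it is at most 1, all factors are at most 1.\<close>

lemma successive_min_last_times_prod_le:
  fixes g :: "real^'k^'k"
  defines "L \<equiv> (\<lambda>x. g *v x) ` int_vecs"
  assumes det: "\<bar>det g\<bar> = 1"
  shows "successive_min CARD('k) L * (\<Prod>i = 1..CARD('k). min 1 (successive_min i L))
           \<le> (2 * real CARD('k)) ^ CARD('k)"
proof -
  let ?d = "CARD('k)"
  obtain B where B: "B \<subseteq> L" "independent B" "card B = ?d"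
    using lattice_full_rank[of g] det unfolding L_def by force
  have nonneg: "0 \<le> successive_min i L" if "i \<le> ?d" for i
    using successive_min_nonneg[OF B(1,2)] that B(3) by simp
  show ?thesis
  proof (cases "successive_min ?d L \<le> 1")
    case True
    have "(\<Prod>i = 1..?d. min 1 (successive_min i L)) \<le> 1"
      using nonneg by (intro prod_le_1) auto
    then have "successive_min ?d L * (\<Prod>i = 1..?d. min 1 (successive_min i L)) \<le> 1 * 1"
      using True nonneg by (intro mult_mono prod_nonneg) auto
    also have "\<dots> \<le> (2 * real ?d) ^ ?d"
    proof -
      have "1 \<le> ?d" using zero_less_card_finite[where 'a = 'k] by linarith
      then have "1 \<le> 2 * real ?d" by linarith
      from one_le_power[OF this, of ?d] show ?thesis by simp
    qed
    finally show ?thesis .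
  next
    case False
    have "?d \<in> {1..?d}" by (simp add: Suc_leI)
    note remove = prod.remove[OF finite_atLeastAtMost this]
    have "successive_min ?d L * (\<Prod>i = 1..?d. min 1 (successive_min i L))
        = successive_min ?d L * (\<Prod>i\<in>{1..?d} - {?d}. min 1 (successive_min i L))"
      using False remove[of "\<lambda>i. min 1 (successive_min i L)"] by simp
    also have "\<dots> \<le> successive_min ?d L * (\<Prod>i\<in>{1..?d} - {?d}. successive_min i L)"
      using nonneg by (intro mult_left_mono prod_mono) auto
    also have "\<dots> = (\<Prod>i = 1..?d. successive_min i L)"
      using remove[of "\<lambda>i. successive_min i L"] by simp
    also have "\<dots> \<le> (2 * real ?d) ^ ?d"
      unfolding L_def by (rule minkowski_second[OF det])
    finally show ?thesis .
  qed
qed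

text \<open>Expand \<open>w\<close> in the basis \<open>S\<close> and round the coefficients down:
  each basis vector contributes an error of at most \<open>\<rho>\<close> per coordinate. It does
  not matter whether \<open>S\<close> generates the whole lattice or a proper sublattice.\<close>

lemma lattice_covering:
  fixes g :: "real^'k^'k" and w :: "real^'k"
  assumes S: "S \<subseteq> (\<lambda>x. g *v x) ` int_vecs" "independent S" "card S = CARD('k)"
    and bound: "\<And>x j. x \<in> S \<Longrightarrow> \<bar>x $ j\<bar> \<le> \<rho>"
  obtains z where "z \<in> int_vecs" "\<And>j. \<bar>(g *v z - w) $ j\<bar> \<le> real CARD('k) * \<rho>"
proof -
  have "finite S" using S(2) by (rule finiteI_independent)
  have "w \<in> span S"
    using card_ge_dim_independent[of S UNIV] S(2,3) by auto
  then obtain c where c: "w = (\<Sum>x\<in>S. c x *\<^sub>R x)"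
    unfolding span_finite[OF \<open>finite S\<close>] by blast
  obtain y where y: "\<And>x. x \<in> S \<Longrightarrow> y x \<in> int_vecs \<and> x = g *v y x"
    using S(1) unfolding subset_iff image_iff by metis
  define z where "z = (\<Sum>x\<in>S. of_int \<lfloor>c x\<rfloor> *\<^sub>R y x)"
  show thesis
  proof
    show "z \<in> int_vecs"
      using y by (auto simp: z_def int_vecs_def intro!: Ints_sum Ints_mult)
    fix j
    have "g *v z = (\<Sum>x\<in>S. of_int \<lfloor>c x\<rfloor> *\<^sub>R (g *v y x))"
      by (simp add: z_def linear_sum[OF matrix_vector_mul_linear] matrix_vector_mult_scaleR)
    also have "\<dots> = (\<Sum>x\<in>S. of_int \<lfloor>c x\<rfloor> *\<^sub>R x)"
      using y by (intro sum.cong) auto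
    finally have "(g *v z - w) $ j = (\<Sum>x\<in>S. (of_int \<lfloor>c x\<rfloor> - c x) * x $ j)"
      by (simp add: c sum_subtractf algebra_simps)
    also have "\<bar>\<dots>\<bar> \<le> (\<Sum>x\<in>S. \<bar>(of_int \<lfloor>c x\<rfloor> - c x) * x $ j\<bar>)"
      by (rule sum_abs)
    also have "\<dots> \<le> (\<Sum>x\<in>S. 1 * \<rho>)"
      unfolding abs_mult
    proof (intro sum_mono mult_mono bound)
      show "\<bar>of_int \<lfloor>c x\<rfloor> - c x\<bar> \<le> 1" for x by linarith
    qed auto
    finally show "\<bar>(g *v z - w) $ j\<bar> \<le> real CARD('k) * \<rho>"
      using S(3) by simp
  qed
qed

section \<open>The unimodular matrices \<open>a_mat t ** u_mat A\<close>\<close>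

lemma sum_Plus_UNIV:
  fixes f :: "'a::finite + 'b::finite \<Rightarrow> 'c::comm_monoid_add"
  shows "sum f UNIV = (\<Sum>a\<in>UNIV. f (Inl a)) + (\<Sum>b\<in>UNIV. f (Inr b))"
  by (simp add: sum.Plus flip: UNIV_Plus_UNIV)

lemma prod_Plus_UNIV:
  fixes f :: "'a::finite + 'b::finite \<Rightarrow> 'c::comm_monoid_mult"
  shows "prod f UNIV = (\<Prod>a\<in>UNIV. f (Inl a)) * (\<Prod>b\<in>UNIV. f (Inr b))"
  by (simp add: prod.Plus flip: UNIV_Plus_UNIV)

lemma det_a_mat: "det (a_mat t :: real^('m::finite + 'n::finite)^('m + 'n)) = 1"
proof -
  have "det (a_mat t :: real^('m + 'n)^('m + 'n))
      = (\<Prod>i\<in>UNIV. (a_mat t :: real^('m + 'n)^('m + 'n)) $ i $ i)"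
    by (rule det_diagonal) (simp add: a_mat_def)
  also have "\<dots> = exp (t / real CARD('m)) ^ CARD('m) * exp (- t / real CARD('n)) ^ CARD('n)"
    by (simp add: prod_Plus_UNIV a_mat_def)
  also have "\<dots> = 1"
    by (simp flip: exp_of_nat_mult exp_add)
  finally show ?thesis .
qed

text \<open>In the permutation expansion only the identity survives: the rows \<open>Inr b\<close>
  vanish off the diagonal, so a contributing permutation fixes every \<open>Inr b\<close>; being
  injective it then sends \<open>Inl a\<close> to some \<open>Inl a'\<close>, and the identity block
  forces \<open>a' = a\<close>.\<close>

lemma det_u_mat:
  fixes A :: "real^'n^'m"
  shows "det (u_mat A) = 1"
proof -
  let ?U = "{p. p permutes (UNIV :: ('m + 'n) set)}"
  let ?f = "\<lambda>p. of_int (sign p) * (\<Prod>i\<in>UNIV. u_mat A $ i $ p i)"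
  have "?f p = 0" if "p \<in> ?U - {id}" for p
  proof (rule ccontr)
    assume "?f p \<noteq> 0"
    then have nz: "u_mat A $ i $ p i \<noteq> 0" for i by simp
    have Inr: "p (Inr b) = Inr b" for b
      using nz[of "Inr b"] by (auto simp: u_mat_def split: if_splits)
    have "p (Inl a) = Inl a" for a
    proof (cases "p (Inl a)")
      case (Inl a')
      then show ?thesis using nz[of "Inl a"] by (auto simp: u_mat_def split: if_splits)
    next
      case (Inr b)
      then have "p (Inl a) = p (Inr b)" using \<open>\<And>b. p (Inr b) = Inr b\<close> by simp
      moreover have "inj p" using that by (auto dest: permutes_inj)
      ultimately show ?thesis by (auto dest: injD)
    qed
    with Inr have "p i = i" for i by (cases i) auto
    then have "p = id" by (simp add: fun_eq_iff)
    with that show False by simp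
  qed
  then have "det (u_mat A) = (\<Sum>p\<in>{id}. ?f p)"
    unfolding det_def by (intro sum.mono_neutral_right) (auto simp: permutes_id)
  also have "\<dots> = 1"
    by (simp add: prod_Plus_UNIV u_mat_def sign_id)
  finally show ?thesis .
qed

lemma det_a_mat_u_mat:
  fixes A :: "real^'n^'m"
  shows "det (a_mat t ** u_mat A) = 1"
  by (simp add: det_mul det_a_mat det_u_mat)

lemma a_mat_image_lattice_of:
  fixes A :: "real^'n^'m"
  shows "(\<lambda>x. a_mat t *v x) ` lattice_of A = (\<lambda>x. (a_mat t ** u_mat A) *v x) ` int_vecs"
  by (simp add: lattice_of_def image_image matrix_vector_mul_assoc)

lemma a_mat_mult_nth:
  fixes x :: "real^('m::finite + 'n::finite)"
  shows "(a_mat t *v x) $ Inl i = exp (t / real CARD('m)) * x $ Inl i"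
    and "(a_mat t *v x) $ Inr j = exp (- t / real CARD('n)) * x $ Inr j"
  by (simp_all add: matrix_vector_mult_def a_mat_def if_distrib[where f = "\<lambda>z. z * _"] cong: if_cong)

lemma u_mat_mult_nth:
  fixes A :: "real^'n^'m"
  shows "(u_mat A *v x) $ Inl i = x $ Inl i + (A *v (\<chi> j. x $ Inr j)) $ i"
    and "(u_mat A *v x) $ Inr j = x $ Inr j"
  by (simp_all add: matrix_vector_mult_def u_mat_def sum_Plus_UNIV if_distrib[where f = "\<lambda>z. z * _"]
      cong: if_cong)

text \<open>The target \<open>w\<close> is the image of \<open>(b, 0)\<close> under
  \<open>a_mat t\<close>. A lattice point near it has coordinates \<open>exp (t / m)\<close> times
  those of \<open>A q + p\<close> and \<open>exp (- t / n)\<close> times those of \<open>q\<close>;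
  undoing the scaling splits the single covering bound into an approximation of \<open>b\<close> and
  a bound on \<open>q\<close>.\<close>

lemma approx_of_successive_min:
  fixes A :: "real^'n^'m"
  assumes "successive_min (CARD('m) + CARD('n)) ((\<lambda>x. a_mat t *v x) ` lattice_of A) < \<rho>"
  obtains p q where "p \<in> int_vecs" "q \<in> int_vecs"
    "infnorm (A *v q + p - b) \<le> (real CARD('m) + real CARD('n)) * \<rho> * exp (- t / real CARD('m))"
    "infnorm q \<le> (real CARD('m) + real CARD('n)) * \<rho> * exp (t / real CARD('n))"
proof -
  define g where "g = a_mat t ** u_mat A"
  have L: "(\<lambda>x. a_mat t *v x) ` lattice_of A = (\<lambda>x. g *v x) ` int_vecs"
    unfolding g_def by (rule a_mat_image_lattice_of)
  have "det g = 1" by (simp add: g_def det_a_mat_u_mat)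
  then obtain B where B: "B \<subseteq> (\<lambda>x. g *v x) ` int_vecs" "independent B" "card B = CARD('m + 'n)"
    using lattice_full_rank[of g] by force
  have d: "CARD('m + 'n) = CARD('m) + CARD('n)" by simp
  obtain S where S: "S \<subseteq> (\<lambda>x. g *v x) ` int_vecs" "independent S" "card S = CARD('m + 'n)"
    "\<And>x j. x \<in> S \<Longrightarrow> \<bar>x $ j\<bar> \<le> \<rho>"
  proof (rule successive_min_less_obtain[OF B(1,2)])
    show "CARD('m + 'n) \<le> card B" using B(3) by simp
    show "successive_min CARD('m + 'n) ((*v) g ` int_vecs) < \<rho>" using assms L d by simp
  qed (rule that)
  define w :: "real^('m + 'n)" where
    "w = (\<chi> i. case i of Inl a \<Rightarrow> exp (t / real CARD('m)) * b $ a | Inr _ \<Rightarrow> 0)"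
  obtain z where z: "z \<in> int_vecs" "\<And>j. \<bar>(g *v z - w) $ j\<bar> \<le> real CARD('m + 'n) * \<rho>"
    using lattice_covering[OF S, where w = w] by blast
  define p q where "p = (\<chi> a. z $ Inl a)" and "q = (\<chi> c. z $ Inr c)"
  have div: "\<bar>y\<bar> \<le> X * exp (- s)" if "\<bar>exp s * y\<bar> \<le> X" for s y X :: real
    using that by (simp add: abs_mult exp_minus field_simps)
  show thesis
  proof
    show "p \<in> int_vecs" "q \<in> int_vecs"
      using z(1) by (auto simp: p_def q_def int_vecs_def)
    show "infnorm (A *v q + p - b) \<le> (real CARD('m) + real CARD('n)) * \<rho> * exp (- t / real CARD('m))"
    proof (rule infnorm_le_cart)
      fix i
      have "(g *v z - w) $ Inl i = exp (t / real CARD('m)) * ((A *v q + p - b) $ i)"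
        by (simp add: g_def w_def p_def q_def a_mat_mult_nth u_mat_mult_nth algebra_simps
            flip: matrix_vector_mul_assoc)
      with z(2)[of "Inl i"] d
      show "\<bar>(A *v q + p - b) $ i\<bar> \<le> (real CARD('m) + real CARD('n)) * \<rho> * exp (- t / real CARD('m))"
        using div[of "t / real CARD('m)"] by simp
    qed
    show "infnorm q \<le> (real CARD('m) + real CARD('n)) * \<rho> * exp (t / real CARD('n))"
    proof (rule infnorm_le_cart)
      fix j
      have "(g *v z - w) $ Inr j = exp (- t / real CARD('n)) * q $ j"
        by (simp add: g_def w_def q_def a_mat_mult_nth u_mat_mult_nth flip: matrix_vector_mul_assoc)
      with z(2)[of "Inr j"] d
      show "\<bar>q $ j\<bar> \<le> (real CARD('m) + real CARD('n)) * \<rho> * exp (t / real CARD('n))"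
        using div[of "- t / real CARD('n)"] by simp
    qed
  qed
qed

lemma successive_min_last_times_Delta_le:
  fixes A :: "real^'n^'m"
  shows "successive_min (CARD('m) + CARD('n))
        ((\<lambda>x. a_mat (real CARD('n) * real k * ln 2) *v x) ` lattice_of A) * Delta k A
      \<le> (2 * real (CARD('m) + CARD('n))) ^ (CARD('m) + CARD('n))"
proof -
  define g where "g = a_mat (real CARD('n) * real k * ln 2) ** u_mat A"
  have L: "(\<lambda>x. a_mat (real CARD('n) * real k * ln 2) *v x) ` lattice_of A = (\<lambda>x. g *v x) ` int_vecs"
    unfolding g_def by (rule a_mat_image_lattice_of)
  have "\<bar>det g\<bar> = 1" by (simp add: g_def det_a_mat_u_mat)
  from successive_min_last_times_prod_le[OF this] show ?thesis
    by (simp add: Delta_def L)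
qed

lemma two_powr_eventually_ge:
  fixes e :: real
  assumes "0 < e"
  shows "\<forall>\<^sub>F k in sequentially. M \<le> 2 powr (e * real k)"
proof (rule eventually_sequentiallyI)
  fix k assume "nat \<lceil>M / (e * ln 2)\<rceil> \<le> k"
  then have "M / (e * ln 2) \<le> real k" by linarith
  then have "M \<le> e * real k * ln 2" using assms by (simp add: field_simps)
  also have "\<dots> \<le> exp (e * real k * ln 2)" using exp_ge_add_one_self[of "e * real k * ln 2"] by linarith
  finally show "M \<le> 2 powr (e * real k)" by (simp add: powr_def)
qed

text \<open>
  The lower bound \<open>K\<close> on the norm of \<open>q\<close> is obtained by approximating \<open>b - A s\<close> for a long integer vector \<open>s\<close>.
\<close>
lemma frequently_dense:
  fixes A :: "real^'n^'m"
  assumes Delta: "\<And>e. 0 < e \<Longrightarrow> \<exists>\<^sub>F k in sequentially. 2 powr (- e * real k) \<le> Delta k A"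
    and "0 < e" "0 \<le> K"
  shows "\<exists>\<^sub>F k in sequentially. \<forall>b. \<exists>q\<in>int_vecs. \<exists>p\<in>int_vecs.
      infnorm (A *v q + p - b) \<le> 2 powr (real k * (e - real CARD('n) / real CARD('m))) \<and>
      K \<le> infnorm q \<and> infnorm q \<le> 2 powr (real k * (1 + e))"
proof -
  let ?d = "CARD('m) + CARD('n)"
  define C where "C = (2 * real ?d) ^ ?d"
  have "0 < 2 * real ?d" by (simp add: add_pos_pos del: of_nat_add)
  then have "0 < C" unfolding C_def by (rule zero_less_power)
  \<comment> \<open>\<open>M\<close> collects all constants that one factor
    \<open>2 powr (e k / 2)\<close> has to absorb: the factor \<open>2 d C\<close> of the
    approximation error, and \<open>4 d C + K + 1\<close> from the length of \<open>s + q\<close>.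
    The other half of \<open>e\<close> pays for the growth of the last minimum.\<close>
  define M where "M = 4 * real ?d * C + K + 1"
  have "0 < e / 2" using \<open>0 < e\<close> by simp
  show ?thesis
    using Delta[OF \<open>0 < e / 2\<close>]
  proof (rule frequently_rev_mp)
    show "\<forall>\<^sub>F k in sequentially. 2 powr (- (e / 2) * real k) \<le> Delta k A \<longrightarrow>
       (\<forall>b. \<exists>q\<in>int_vecs. \<exists>p\<in>int_vecs.
      infnorm (A *v q + p - b) \<le> 2 powr (real k * (e - real CARD('n) / real CARD('m))) \<and>
      K \<le> infnorm q \<and> infnorm q \<le> 2 powr (real k * (1 + e)))"
      using two_powr_eventually_ge[OF \<open>0 < e / 2\<close>, of M]
    proof (rule eventually_mono, intro impI allI)
      fix k and b :: "real^'m"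
      assume k: "M \<le> 2 powr (e / 2 * real k)" and low: "2 powr (- (e / 2) * real k) \<le> Delta k A"
      define t where "t = real CARD('n) * real k * ln 2"
      define lam where "lam = successive_min ?d ((\<lambda>x. a_mat t *v x) ` lattice_of A)"
      define E where "E = 2 powr (e / 2 * real k)"
      have "0 < E" by (simp add: E_def)
      have "lam * Delta k A \<le> C"
        unfolding lam_def C_def t_def by (rule successive_min_last_times_Delta_le)
      \<comment> \<open>\<open>Delta k A \<ge> 1 / E\<close> gives \<open>lam \<le> C * E\<close>;
        the factor 2 makes the inequality strict, as \<open>approx_of_successive_min\<close>
        needs.\<close>
      have "lam < 2 * C * E"
      proof (rule ccontr)
        assume "\<not> lam < 2 * C * E"
        moreover from this have "0 \<le> lam"
          using mult_pos_pos[OF \<open>0 < C\<close> \<open>0 < E\<close>] by simp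
        ultimately have "2 * C * E * (1 / E) \<le> lam * Delta k A"
          using low \<open>0 < C\<close> \<open>0 < E\<close> by (intro mult_mono) (auto simp: E_def powr_minus_divide)
        with \<open>lam * Delta k A \<le> C\<close> \<open>0 < C\<close> \<open>0 < E\<close> show False by simp
      qed
      define R where "R = real ?d * (2 * C * E) * 2 powr real k"
      have "0 \<le> R" using \<open>0 < C\<close> \<open>0 < E\<close> by (simp add: R_def)
      have exps: "exp (- t / real CARD('m)) = 2 powr (real k * (- (real CARD('n) / real CARD('m))))"
        "exp (t / real CARD('n)) = 2 powr real k"
        by (simp_all add: t_def powr_def)
      define s :: "real^'n" where "s = (\<chi> i. of_int \<lceil>R + K\<rceil>)"
      have s: "s \<in> int_vecs" by (simp add: s_def int_vecs_def)
      have norm_s: "R + K \<le> infnorm s" "infnorm s \<le> R + K + 1"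
      proof -
        have "R + K \<le> \<bar>s $ undefined\<bar>" by (simp add: s_def) linarith
        then show "R + K \<le> infnorm s" using component_le_infnorm_cart[of s undefined] by linarith
        show "infnorm s \<le> R + K + 1"
        proof (rule infnorm_le_cart)
          fix i
          have "s $ i = of_int \<lceil>R + K\<rceil>" by (simp add: s_def)
          then show "\<bar>s $ i\<bar> \<le> R + K + 1" using \<open>0 \<le> R\<close> \<open>0 \<le> K\<close> by linarith
        qed
      qed
      obtain p q where pq: "p \<in> int_vecs" "q \<in> int_vecs"
        "infnorm (A *v q + p - (b - A *v s))
            \<le> (real CARD('m) + real CARD('n)) * (2 * C * E) * exp (- t / real CARD('m))"
        "infnorm q \<le> (real CARD('m) + real CARD('n)) * (2 * C * E) * exp (t / real CARD('n))"
        using approx_of_successive_min[where A = A and t = t and \<rho> = "2 * C * E" and b = "b - A *v s"] \<open>lam < 2 * C * E\<close>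
        unfolding lam_def by blast
      have q: "infnorm q \<le> R" using pq(4) by (simp add: R_def exps)
      have E2: "E * E = 2 powr (real k * e)"
        by (simp add: E_def field_simps flip: powr_add)
      have dC: "real ?d * (2 * C) \<le> E"
      proof -
        define y where "y = real ?d * C"
        have "0 \<le> y" "real ?d * (2 * C) = 2 * y" "M = 4 * y + K + 1"
          using \<open>0 < C\<close> by (simp_all add: y_def M_def mult.assoc del: of_nat_add)
        then show ?thesis using k \<open>0 \<le> K\<close> unfolding E_def by linarith
      qed
      show "\<exists>q\<in>int_vecs. \<exists>p\<in>int_vecs.
        infnorm (A *v q + p - b) \<le> 2 powr (real k * (e - real CARD('n) / real CARD('m))) \<and>
        K \<le> infnorm q \<and> infnorm q \<le> 2 powr (real k * (1 + e))"
      proof (intro bexI conjI)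
        show "s + q \<in> int_vecs" using s pq(2) by (rule int_vecs_add)
        show "p \<in> int_vecs" by fact
        have "infnorm (A *v (s + q) + p - b) = infnorm (A *v q + p - (b - A *v s))"
          by (simp add: matrix_vector_right_distrib algebra_simps)
        also have "\<dots> \<le> (real ?d * (2 * C)) * E * exp (- t / real CARD('m))"
          using pq(3) by (simp add: algebra_simps)
        also have "\<dots> \<le> E * E * exp (- t / real CARD('m))"
          using dC \<open>0 < E\<close> by (intro mult_right_mono) auto
        also have "\<dots> = 2 powr (real k * (e - real CARD('n) / real CARD('m)))"
          by (simp only: E2 exps powr_add[symmetric]) (simp add: algebra_simps)
        finally show "infnorm (A *v (s + q) + p - b) \<le> 2 powr (real k * (e - real CARD('n) / real CARD('m)))" .
        have "infnorm s \<le> infnorm (s + q) + infnorm q"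
          using infnorm_triangle[of "s + q" "- q"] by (simp add: infnorm_neg)
        then show "K \<le> infnorm (s + q)" using norm_s(1) q by linarith
        have "infnorm (s + q) \<le> infnorm s + infnorm q" by (rule infnorm_triangle)
        also have "\<dots> \<le> 2 * R + (K + 1) * 1" using norm_s(2) q by simp
        also have "\<dots> \<le> 2 * R + (K + 1) * (E * 2 powr real k)"
        proof -
          have "1 * 1 \<le> E * 2 powr real k"
            using \<open>0 < e\<close> by (intro mult_mono) (auto simp: E_def ge_one_powr_ge_zero)
          then show ?thesis using \<open>0 \<le> K\<close> by (intro add_left_mono mult_left_mono) auto
        qed
        also have "\<dots> = M * (E * 2 powr real k)"
          by (simp add: R_def M_def algebra_simps)
        also have "\<dots> \<le> E * (E * 2 powr real k)"
          using k \<open>0 < E\<close> by (intro mult_right_mono) (auto simp: E_def)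
        also have "\<dots> = E * E * 2 powr real k" by simp
        also have "\<dots> = 2 powr (real k * (1 + e))"
          by (simp only: E2 powr_add[symmetric]) (simp add: algebra_simps)
        finally show "infnorm (s + q) \<le> 2 powr (real k * (1 + e))" .
      qed
    qed
  qed
qed

subsection \<open>Avoiding a cover\<close>

lemma infnorm_minus_triangle: "infnorm (x - y) \<le> infnorm (x - w) + infnorm (w - y)"
  using infnorm_triangle[of "x - w" "w - y"] by simp

lemma card_nat_near:
  fixes c l :: real
  assumes "0 \<le> l"
  shows "finite {k::nat. \<bar>real k - c\<bar> \<le> l}" and "real (card {k::nat. \<bar>real k - c\<bar> \<le> l}) \<le> 2 * l + 1"
proof -
  let ?I = "{\<lceil>c - l\<rceil>..\<lfloor>c + l\<rfloor>}"
  have sub: "{k::nat. \<bar>real k - c\<bar> \<le> l} \<subseteq> nat ` ?I"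
  proof
    fix k :: nat assume "k \<in> {k. \<bar>real k - c\<bar> \<le> l}"
    then have "c - l \<le> real k" "real k \<le> c + l" by auto
    then have "int k \<in> ?I" by (simp add: ceiling_le_iff le_floor_iff)
    then show "k \<in> nat ` ?I" by force
  qed
  show "finite {k::nat. \<bar>real k - c\<bar> \<le> l}"
    using sub by (rule finite_subset) simp
  have "card {k::nat. \<bar>real k - c\<bar> \<le> l} \<le> card (nat ` ?I)"
    using sub by (intro card_mono) auto
  also have "\<dots> \<le> card ?I" by (intro card_image_le) simp
  finally have "real (card {k::nat. \<bar>real k - c\<bar> \<le> l}) \<le> real (card ?I)" by simp
  also have "\<dots> \<le> 2 * l + 1" using assms by simp linarith
  finally show "real (card {k::nat. \<bar>real k - c\<bar> \<le> l}) \<le> 2 * l + 1" .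
qed

lemma card_fun_near:
  fixes u0 :: "'m::finite \<Rightarrow> nat"
  assumes "0 \<le> l" and near: "\<And>u i. u \<in> S \<Longrightarrow> \<bar>real (u i) - real (u0 i)\<bar> \<le> l"
  shows "real (card S) \<le> (2 * l + 1) ^ CARD('m)"
proof -
  let ?A = "\<lambda>i. {k::nat. \<bar>real k - real (u0 i)\<bar> \<le> l}"
  have "S \<subseteq> Pi\<^sub>E UNIV ?A" using near by auto
  then have "card S \<le> card (Pi\<^sub>E UNIV ?A)"
    using card_nat_near(1)[OF assms(1)] by (intro card_mono finite_PiE) auto
  then have "real (card S) \<le> real (card (Pi\<^sub>E UNIV ?A))" by simp
  also have "\<dots> = (\<Prod>i\<in>UNIV. real (card (?A i)))"
    by (simp add: card_PiE)
  also have "\<dots> \<le> (\<Prod>i\<in>(UNIV :: 'm set). 2 * l + 1)"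
    using card_nat_near(2)[OF assms(1)] by (intro prod_mono) auto
  finally show ?thesis by simp
qed

text \<open>
  The candidates are the approximations \<open>f b\<close> of the points \<open>b\<close> of a grid of mesh \<open>4 r\<close> around \<open>z\<close>. A set
  \<open>V i\<close> meeting the ball around a candidate is charged \<open>\<theta>\<close> if \<open>r \<le> \<eta> i\<close> and
  \<open>min 1 ((\<eta> i / \<rho>') powr s)\<close> otherwise; on average a candidate is charged at most \<open>\<theta> / 2\<close>, while every
  candidate violating the conclusion is charged at least \<open>\<theta>\<close>.
\<close>
lemma good_child_exists:
  fixes V :: "nat \<Rightarrow> (real^'m) set" and \<eta> :: "nat \<Rightarrow> real" and f :: "real^'m \<Rightarrow> real^'m"
  assumes s: "0 < s" "s \<le> real CARD('m)"
    and V: "\<And>i x y. x \<in> V i \<Longrightarrow> y \<in> V i \<Longrightarrow> infnorm (x - y) \<le> \<eta> i" "\<And>i. 0 < \<eta> i"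
    and \<theta>: "0 < \<theta>" "\<theta> \<le> 1" "2 * 64 ^ CARD('m) * \<theta> \<le> 1"
    and inv: "\<And>J. finite J \<Longrightarrow> (\<And>i. i \<in> J \<Longrightarrow> \<exists>x\<in>V i. infnorm (x - z) \<le> \<rho>) \<Longrightarrow>
                (\<Sum>i\<in>J. \<eta> i powr s) \<le> \<theta> * \<rho> powr s"
    and r: "0 < \<rho>'" "\<rho>' \<le> r" "16 * r \<le> \<rho>"
    and big: "2 * 4 ^ CARD('m) * (\<rho> / \<rho>') powr s \<le> (\<rho> / (16 * r)) ^ CARD('m)"
    and dense: "\<And>b. infnorm (f b - b) \<le> r"
  shows "\<exists>b. infnorm (f b - z) + \<rho>' \<le> \<rho> \<and>
           (\<forall>J. finite J \<longrightarrow> (\<forall>i\<in>J. \<exists>x\<in>V i. infnorm (x - f b) \<le> \<rho>') \<longrightarrow>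
                (\<Sum>i\<in>J. \<eta> i powr s) \<le> \<theta> * \<rho>' powr s)"
proof (rule ccontr)
  let ?D = "CARD('m)"
  have pos: "0 < r" "0 < \<rho>" using r by linarith+
  have norm_sym: "infnorm (x - y) = infnorm (y - x)" for x y :: "real^'m"
    by (metis infnorm_neg minus_diff_eq)
  note tri = infnorm_minus_triangle
  \<comment> \<open>\<open>M\<close> points per axis with mesh \<open>4 r\<close> keep the grid
    within \<open>\<rho> / 2\<close> of \<open>z\<close>, leaving room for the error
    \<open>r\<close> and the radius \<open>\<rho>'\<close>. As
    \<open>\<rho> / (8 r) \<ge> 2\<close>, rounding down costs at most a factor 2.\<close>
  define M where "M = nat \<lfloor>\<rho> / (8 * r)\<rfloor>"
  define N where "N = real M ^ ?D"
  have "2 \<le> \<rho> / (8 * r)" using r(3) pos by (simp add: field_simps)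
  then have "\<rho> / (8 * r) \<le> 2 * real M" "real M \<le> \<rho> / (8 * r)"
    unfolding M_def by linarith+
  then have M: "\<rho> / (16 * r) \<le> real M" "8 * r * real M \<le> \<rho>"
    using pos by (auto simp: field_simps)
  have N_ge: "(\<rho> / (16 * r)) ^ ?D \<le> N"
    unfolding N_def using M(1) pos by (intro power_mono) auto
  have "0 < (\<rho> / (16 * r)) ^ ?D" using pos by simp
  with N_ge have "0 < N" by linarith
  define G :: "('m \<Rightarrow> nat) set" where "G = Pi\<^sub>E UNIV (\<lambda>_. {0..<M})"
  have "finite G" unfolding G_def by (intro finite_PiE) auto
  have card_G: "real (card G) = N" by (simp add: G_def card_PiE N_def)
  define b :: "('m \<Rightarrow> nat) \<Rightarrow> real^'m" where "b u = z + (\<chi> i. 4 * r * real (u i))" for u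
  have fb: "infnorm (f (b u) - z) + \<rho>' \<le> \<rho>" if "u \<in> G" for u
  proof -
    have "infnorm (b u - z) \<le> \<rho> / 2"
    proof (rule infnorm_le_cart)
      fix i
      have "u i \<in> {0..<M}" using that by (auto simp: G_def)
      then have "4 * r * real (u i) \<le> 4 * r * real M" using pos by (intro mult_left_mono) auto
      also have "\<dots> \<le> \<rho> / 2" using M(2) by simp
      finally show "\<bar>(b u - z) $ i\<bar> \<le> \<rho> / 2" using pos by (simp add: b_def)
    qed
    then show ?thesis using tri[of "f (b u)" z "b u"] dense[of "b u"] r by linarith
  qed
  assume "\<not> ?thesis"
  then have "\<forall>u\<in>G. \<exists>J. finite J \<and> (\<forall>i\<in>J. \<exists>x\<in>V i. infnorm (x - f (b u)) \<le> \<rho>') \<and>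
      \<theta> * \<rho>' powr s < (\<Sum>i\<in>J. \<eta> i powr s)"
    using fb by (metis not_le)
  then obtain J where J: "\<And>u. u \<in> G \<Longrightarrow> finite (J u)"
    "\<And>u i. u \<in> G \<Longrightarrow> i \<in> J u \<Longrightarrow> \<exists>x\<in>V i. infnorm (x - f (b u)) \<le> \<rho>'"
    "\<And>u. u \<in> G \<Longrightarrow> \<theta> * \<rho>' powr s < (\<Sum>i\<in>J u. \<eta> i powr s)"
    by metis
  \<comment> \<open>A large set may meet the balls of very many candidates. Charging it just
    \<open>\<theta>\<close>, which is still enough to rule a candidate out, provides the factor that
    later absorbs \<open>64 ^ CARD('m)\<close>.\<close>
  define w where "w i = (if r \<le> \<eta> i then \<theta> else min 1 ((\<eta> i / \<rho>') powr s))" for i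
  have w_nonneg: "0 \<le> w i" for i using \<theta>(1) by (simp add: w_def)
  \<comment> \<open>One set with \<open>\<eta> i \<ge> \<rho>'\<close> pays \<open>\<theta>\<close>
    alone. If there is none, no truncation takes effect, and the charges are the terms of the
    violated mass bound divided by \<open>\<rho>' powr s\<close>.\<close>
  have lower: "\<theta> \<le> (\<Sum>i\<in>J u. w i)" if u: "u \<in> G" for u
  proof (cases "\<exists>i\<in>J u. \<rho>' \<le> \<eta> i")
    case True
    then obtain i where i: "i \<in> J u" "\<rho>' \<le> \<eta> i" by blast
    have "1 \<le> (\<eta> i / \<rho>') powr s"
      using i(2) r(1) s(1) by (intro ge_one_powr_ge_zero) (auto simp: field_simps)
    then have "\<theta> \<le> w i" using \<theta>(2) by (simp add: w_def)
    also have "\<dots> \<le> (\<Sum>i\<in>J u. w i)"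
      using i(1) J(1)[OF u] w_nonneg by (intro member_le_sum) auto
    finally show ?thesis .
  next
    case False
    have "w i = \<eta> i powr s / \<rho>' powr s" if "i \<in> J u" for i
    proof -
      have "\<eta> i < \<rho>'" using False that by force
      moreover have "(\<eta> i / \<rho>') powr s \<le> 1"
        using \<open>\<eta> i < \<rho>'\<close> V(2)[of i] r(1) s(1) by (intro powr_le1) auto
      moreover have "(\<eta> i / \<rho>') powr s = \<eta> i powr s / \<rho>' powr s"
        using V(2)[of i] r(1) by (simp add: powr_divide)
      ultimately show ?thesis using r(2) by (simp add: w_def)
    qed
    then have "(\<Sum>i\<in>J u. w i) = (\<Sum>i\<in>J u. \<eta> i powr s) / \<rho>' powr s"
      by (simp add: sum_divide_distrib)
    moreover have P: "0 < \<rho>' powr s" using r(1) by simp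
    ultimately have "(\<Sum>i\<in>J u. \<eta> i powr s) = (\<Sum>i\<in>J u. w i) * \<rho>' powr s" by simp
    then show ?thesis using J(3)[OF u] mult_less_cancel_right_pos[OF P] by simp
  qed
  define U where "U = (\<Union>u\<in>G. J u)"
  have "finite U" using \<open>finite G\<close> J(1) by (auto simp: U_def)
  have U_meets: "\<exists>x\<in>V i. infnorm (x - z) \<le> \<rho>" if "i \<in> U" for i
  proof -
    obtain u where u: "u \<in> G" "i \<in> J u" using \<open>i \<in> U\<close> by (auto simp: U_def)
    obtain x where x: "x \<in> V i" "infnorm (x - f (b u)) \<le> \<rho>'" using J(2)[OF u] by blast
    have "infnorm (x - z) \<le> \<rho>" using tri[of x z "f (b u)"] x(2) fb[OF u(1)] by linarith
    with x(1) show ?thesis by blast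
  qed
  have \<eta>_le: "\<eta> i \<le> \<rho>" if "i \<in> U" for i
  proof (rule ccontr)
    assume "\<not> \<eta> i \<le> \<rho>"
    then have "\<rho> powr s < \<eta> i powr s" using pos s(1) by (intro powr_less_mono2) auto
    also have "\<dots> \<le> \<theta> * \<rho> powr s" using inv[of "{i}"] U_meets[OF that] by simp
    also have "\<dots> \<le> 1 * \<rho> powr s" using \<theta>(2) by (intro mult_right_mono) auto
    finally show False by simp
  qed
  define c where "c i = real (card {u \<in> G. i \<in> J u})" for i
  have c_le: "c i \<le> (4 * max 1 (\<eta> i / r)) ^ ?D" if "i \<in> U" for i
  proof -
    obtain u0 where u0: "u0 \<in> G" "i \<in> J u0" using \<open>i \<in> U\<close> by (auto simp: U_def)
    \<comment> \<open>Two grid points whose candidate balls meet \<open>V i\<close> are at distance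
      at most \<open>2 r + 2 \<rho>' + \<eta> i \<le> 4 r + \<eta> i\<close>; \<open>l\<close> is
      this distance measured in units of the mesh \<open>4 r\<close>.\<close>
    define l where "l = 1 + \<eta> i / (4 * r)"
    have "0 \<le> l" using V(2)[of i] pos by (simp add: l_def add_nonneg_nonneg)
    have "c i \<le> (2 * l + 1) ^ ?D"
      unfolding c_def
    proof (rule card_fun_near[OF \<open>0 \<le> l\<close>])
      fix u j assume "u \<in> {u \<in> G. i \<in> J u}"
      then have u: "u \<in> G" "i \<in> J u" by auto
      obtain x where x: "x \<in> V i" "infnorm (x - f (b u)) \<le> \<rho>'" using J(2)[OF u] by blast
      obtain y where y: "y \<in> V i" "infnorm (y - f (b u0)) \<le> \<rho>'" using J(2)[OF u0] by blast
      have "infnorm (b u - b u0) \<le> 4 * r + \<eta> i"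
        using tri[of "b u" "b u0" "f (b u)"] tri[of "f (b u)" "b u0" x] tri[of x "b u0" y]
          tri[of y "b u0" "f (b u0)"] dense[of "b u"] dense[of "b u0"] x(2) y(2) V(1)[OF x(1) y(1)]
          norm_sym[of "b u" "f (b u)"] norm_sym[of x "f (b u)"] r(2) by linarith
      moreover have "\<bar>(b u - b u0) $ j\<bar> = 4 * r * \<bar>real (u j) - real (u0 j)\<bar>"
        using pos by (simp add: b_def abs_mult flip: right_diff_distrib)
      ultimately have "4 * r * \<bar>real (u j) - real (u0 j)\<bar> \<le> 4 * r + \<eta> i"
        using component_le_infnorm_cart[of "b u - b u0" j] by linarith
      then show "\<bar>real (u j) - real (u0 j)\<bar> \<le> l"
        using pos by (simp add: l_def field_simps)
    qed
    also have "\<dots> \<le> (4 * max 1 (\<eta> i / r)) ^ ?D"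
    proof (rule power_mono)
      have "2 * l + 1 = 3 + \<eta> i / r / 2" by (simp add: l_def)
      moreover have "3 + y / 2 \<le> 4 * max 1 y" for y :: real
        by (cases "1 \<le> y") (auto simp: max_def)
      ultimately show "2 * l + 1 \<le> 4 * max 1 (\<eta> i / r)" by simp
    qed (use \<open>0 \<le> l\<close> in simp)
    finally show ?thesis .
  qed
  \<comment> \<open>For \<open>\<eta> i \<ge> r\<close> the count is at most
    \<open>(4 \<eta> i / r) ^ m\<close>, that is \<open>64 ^ m\<close> times
    \<open>(\<rho> / (16 r)) ^ m * (\<eta> i / \<rho>) ^ m\<close>, with \<open>64 = 4 * 16\<close>;
    here \<open>\<theta>\<close> absorbs \<open>64 ^ m\<close>, and
    \<open>\<eta> i \<le> \<rho>\<close> with \<open>s \<le> m\<close> lowers the last exponent to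
    \<open>s\<close>. For \<open>\<eta> i < r\<close> the count is at most \<open>4 ^ m\<close>, and
    \<open>big\<close> pays for the passage from \<open>\<rho>'\<close> to
    \<open>\<rho>\<close>.\<close>
  have upper: "c i * w i \<le> N / 2 * (\<eta> i powr s / \<rho> powr s)" if i: "i \<in> U" for i
  proof -
    have ratio: "(\<eta> i / \<rho>) powr s = \<eta> i powr s / \<rho> powr s"
      using V(2)[of i] pos by (simp add: powr_divide)
    show ?thesis
    proof (cases "r \<le> \<eta> i")
      case True
      have "(\<eta> i / \<rho>) ^ ?D = (\<eta> i / \<rho>) powr real ?D"
        using V(2)[of i] pos by (simp add: powr_realpow)
      also have "\<dots> \<le> (\<eta> i / \<rho>) powr s"
        using V(2)[of i] pos \<eta>_le[OF i] s(2) by (intro powr_mono') auto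
      finally have pw: "(\<eta> i / \<rho>) ^ ?D \<le> (\<eta> i / \<rho>) powr s" .
      have "c i * w i \<le> (4 * (\<eta> i / r)) ^ ?D * \<theta>"
        using c_le[OF i] True pos \<theta>(1) by (intro mult_mono) (auto simp: w_def max_def field_simps split: if_splits)
      also have "(4 * (\<eta> i / r)) ^ ?D = 64 ^ ?D * ((\<rho> / (16 * r)) ^ ?D * (\<eta> i / \<rho>) ^ ?D)"
        using pos by (simp flip: power_mult_distrib)
      also have "\<dots> * \<theta> = (64 ^ ?D * \<theta>) * ((\<rho> / (16 * r)) ^ ?D * (\<eta> i / \<rho>) ^ ?D)"
        by simp
      also have "\<dots> \<le> (1 / 2) * (N * (\<eta> i / \<rho>) powr s)"
        using \<theta> N_ge pw V(2)[of i] pos \<open>0 < N\<close>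
        by (intro mult_mono) auto
      finally show ?thesis by (simp add: ratio)
    next
      case False
      have "max 1 (\<eta> i / r) = 1" using False pos by (simp add: max_def field_simps)
      then have "c i * w i \<le> 4 ^ ?D * (\<eta> i / \<rho>') powr s"
        using c_le[OF i] False w_nonneg by (intro mult_mono) (auto simp: w_def)
      also have "(\<eta> i / \<rho>') powr s = (\<rho> / \<rho>') powr s * (\<eta> i / \<rho>) powr s"
        using V(2)[of i] pos r(1) by (simp flip: powr_mult)
      also have "4 ^ ?D * \<dots> = (2 * 4 ^ ?D * (\<rho> / \<rho>') powr s) * ((\<eta> i / \<rho>) powr s / 2)"
        by simp
      also have "\<dots> \<le> N * ((\<eta> i / \<rho>) powr s / 2)"
        using big N_ge by (intro mult_right_mono) auto
      finally show ?thesis by (simp add: ratio)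
    qed
  qed
  have "N * \<theta> = (\<Sum>u\<in>G. \<theta>)" by (simp add: card_G)
  also have "\<dots> \<le> (\<Sum>u\<in>G. \<Sum>i\<in>J u. w i)" by (intro sum_mono lower)
  also have "\<dots> = (\<Sum>u\<in>G. \<Sum>i\<in>U. if i \<in> J u then w i else 0)"
  proof (rule sum.cong)
    fix u assume "u \<in> G"
    then have "J u = {i \<in> U. i \<in> J u}" by (auto simp: U_def)
    then show "(\<Sum>i\<in>J u. w i) = (\<Sum>i\<in>U. if i \<in> J u then w i else 0)"
      using sum.inter_filter[OF \<open>finite U\<close>, of w "\<lambda>i. i \<in> J u"] by simp
  qed simp
  also have "\<dots> = (\<Sum>i\<in>U. \<Sum>u\<in>G. if i \<in> J u then w i else 0)" by (rule sum.swap)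
  also have "\<dots> = (\<Sum>i\<in>U. c i * w i)"
  proof (rule sum.cong)
    show "(\<Sum>u\<in>G. if i \<in> J u then w i else 0) = c i * w i" for i
      using sum.inter_filter[OF \<open>finite G\<close>, of "\<lambda>_. w i" "\<lambda>u. i \<in> J u"] by (simp add: c_def)
  qed simp
  also have "\<dots> \<le> (\<Sum>i\<in>U. N / 2 * (\<eta> i powr s / \<rho> powr s))"
    by (intro sum_mono upper)
  also have "\<dots> = N / 2 * ((\<Sum>i\<in>U. \<eta> i powr s) / \<rho> powr s)"
    by (simp add: sum_distrib_left sum_divide_distrib)
  also have "\<dots> \<le> N / 2 * \<theta>"
    using inv[OF \<open>finite U\<close> U_meets] pos \<open>0 < N\<close> by (intro mult_left_mono) (auto simp: field_simps)
  finally show False using \<open>0 < N\<close> \<theta>(1) by simp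
qed

text \<open>
  Invariant of the Cantor-type construction: of the total \<open>s\<close>-mass of the covering sets, at most
  \<open>\<theta> * \<rho> powr s\<close> comes from sets meeting the ball of radius \<open>\<rho>\<close> around \<open>z\<close>. Quantifying over finite
  subfamilies avoids summability side conditions.
\<close>
definition light :: "(nat \<Rightarrow> (real^'m) set) \<Rightarrow> (nat \<Rightarrow> real) \<Rightarrow> real \<Rightarrow> real \<Rightarrow> real^'m \<Rightarrow> real \<Rightarrow> bool" where
  "light V \<eta> s \<theta> z \<rho> \<longleftrightarrow>
     (\<forall>J. finite J \<longrightarrow> (\<forall>i\<in>J. \<exists>x\<in>V i. infnorm (x - z) \<le> \<rho>) \<longrightarrow>
        (\<Sum>i\<in>J. \<eta> i powr s) \<le> \<theta> * \<rho> powr s)"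

text \<open>The singleton \<open>J = {i}\<close> already gives this. Along light balls whose radii
  tend to 0, a common point of all the balls cannot lie in any \<open>V i\<close>, because
  \<open>\<eta> i\<close> is positive.\<close>

lemma lightD:
  assumes "light V \<eta> s \<theta> z \<rho>" "x \<in> V i" "infnorm (x - z) \<le> \<rho>" "0 < \<rho>" "0 < s" "\<theta> \<le> 1"
  shows "\<eta> i \<le> \<rho>"
proof (rule ccontr)
  assume "\<not> \<eta> i \<le> \<rho>"
  then have "\<rho> powr s < \<eta> i powr s" using assms(4,5) by (intro powr_less_mono2) auto
  also have "(\<Sum>i\<in>{i}. \<eta> i powr s) \<le> \<theta> * \<rho> powr s"
    using assms(1-3) unfolding light_def by blast
  then have "\<eta> i powr s \<le> \<theta> * \<rho> powr s" by simp
  also have "\<dots> \<le> 1 * \<rho> powr s" using assms(6) by (intro mult_right_mono) auto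
  finally show False by simp
qed

text \<open>At a good scale \<open>k\<close> the approximations are \<open>r\<close>-dense with
  \<open>r = 2 powr (- k (n / m - e))\<close> and have
  \<open>|q| \<le> Q = 2 powr (k (1 + e))\<close>, so every child may be given a radius just below
  \<open>Q powr (- v)\<close>. What must be checked for \<open>good_child_exists\<close> is that the
  number of children beats the loss of mass.\<close>

lemma light_step:
  fixes A :: "real^'n^'m" and V :: "nat \<Rightarrow> (real^'m) set"
  assumes Delta: "\<And>e. 0 < e \<Longrightarrow> \<exists>\<^sub>F k in sequentially. 2 powr (- e * real k) \<le> Delta k A"
    and s: "0 < s" "s \<le> real CARD('m)" "v * s < real CARD('n)"
    and v: "real CARD('n) / real CARD('m) \<le> v"
    and V: "\<And>i x y. x \<in> V i \<Longrightarrow> y \<in> V i \<Longrightarrow> infnorm (x - y) \<le> \<eta> i" "\<And>i. 0 < \<eta> i"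
    and \<theta>: "0 < \<theta>" "\<theta> \<le> 1" "2 * 64 ^ CARD('m) * \<theta> \<le> 1"
    and light: "light V \<eta> s \<theta> z \<rho>" and "0 < \<rho>" "0 < K"
  obtains q p \<rho>' where "q \<in> int_vecs" "p \<in> int_vecs" "light V \<eta> s \<theta> (A *v q + p) \<rho>'"
    "0 < \<rho>'" "\<rho>' \<le> \<rho> / 2" "infnorm (A *v q + p - z) + \<rho>' \<le> \<rho>" "K \<le> infnorm q"
    "\<rho>' < infnorm q powr (- v)"
proof -
  let ?m = "real CARD('m)" and ?n = "real CARD('n)"
  have mn: "0 < ?m" "0 < ?n" by simp_all
  have "0 < v" using v mn by (meson divide_pos_pos less_le_trans)
  then have vs: "0 < v * s" using s(1) by simp
  \<comment> \<open>Solves \<open>e (v s + m) = (n - v s) / 2\<close>: the losses consume half of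
    the gap \<open>n - v s\<close>, and the other half remains as \<open>\<sigma>\<close>.\<close>
  define e where "e = (?n - v * s) / (2 * (v * s + ?m))"
  have "0 < v * s + ?m" using vs mn by linarith
  then have "0 < e" using s(3) by (simp add: e_def)
  moreover have "2 * (a / (2 * X) * X) = a" if "0 < X" for a X :: real using that by simp
  from this[OF \<open>0 < v * s + ?m\<close>, of "?n - v * s"]
  have "2 * (e * (v * s + ?m)) = ?n - v * s" unfolding e_def .
  ultimately have e: "0 < e" "2 * (e * (v * s + ?m)) = ?n - v * s" by blast+
  have e_ub: "e < ?n / ?m"
  proof -
    have "e * ?m \<le> e * (v * s + ?m)" using e(1) vs by (intro mult_left_mono) auto
    then have "e * ?m < ?n" using e(2) vs mn by linarith
    then show ?thesis using mn by (simp add: field_simps)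
  qed
  \<comment> \<open>The exponent of \<open>2 ^ k\<close> in \<open>(1 / r) ^ m\<close> divided by
    \<open>Q powr (v s)\<close>. Its positivity yields \<open>big\<close> for large
    \<open>k\<close>, whatever \<open>\<rho>\<close> is.\<close>
  define \<sigma> where "\<sigma> = ?n - e * ?m - (1 + e) * (v * s)"
  have "0 < \<sigma>"
  proof -
    have "\<sigma> = (?n - v * s) - e * (v * s + ?m)" by (simp add: \<sigma>_def algebra_simps)
    then show ?thesis using e(2) s(3) by linarith
  qed
  let ?r = "\<lambda>k. 2 powr (real k * (e - ?n / ?m))"
  let ?Q = "\<lambda>k. 2 powr (real k * (1 + e))"
  let ?dense = "\<lambda>k. \<forall>b. \<exists>q\<in>int_vecs. \<exists>p\<in>int_vecs.
      infnorm (A *v q + p - b) \<le> ?r k \<and> K \<le> infnorm q \<and> infnorm q \<le> ?Q k"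
  have "0 < ?n / ?m - e" using e_ub by simp
  have "\<exists>\<^sub>F k in sequentially. ?dense k"
    using frequently_dense[OF Delta e(1)] \<open>0 < K\<close> by simp
  moreover have "\<forall>\<^sub>F k in sequentially. 16 / \<rho> \<le> 2 powr ((?n / ?m - e) * real k)"
    by (rule two_powr_eventually_ge) fact
  moreover have "\<forall>\<^sub>F k in sequentially.
      2 * 4 ^ CARD('m) * (2 * \<rho>) powr s * (16 / \<rho>) ^ CARD('m) \<le> 2 powr (\<sigma> * real k)"
    by (rule two_powr_eventually_ge) fact
  ultimately have "\<exists>\<^sub>F k in sequentially. ?dense k \<and> 16 / \<rho> \<le> 2 powr ((?n / ?m - e) * real k) \<and>
      2 * 4 ^ CARD('m) * (2 * \<rho>) powr s * (16 / \<rho>) ^ CARD('m) \<le> 2 powr (\<sigma> * real k)"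
    by (intro frequently_eventually_frequently eventually_conj)
  then obtain k where dense: "?dense k" and k1: "16 / \<rho> \<le> 2 powr ((?n / ?m - e) * real k)"
    and k2: "2 * 4 ^ CARD('m) * (2 * \<rho>) powr s * (16 / \<rho>) ^ CARD('m) \<le> 2 powr (\<sigma> * real k)"
    by (blast dest: frequently_ex)
  define r where "r = ?r k"
  \<comment> \<open>The division by 2 makes the radius strictly smaller than
    \<open>|q| powr (- v)\<close>, so that even limit points on the boundary of the ball satisfy the
    strict inequality in \<open>W\<close>.\<close>
  define \<rho>' where "\<rho>' = ?Q k powr (- v) / 2"
  have "0 < r" "0 < \<rho>'" by (simp_all add: r_def \<rho>'_def)
  have r_eq: "1 / r = 2 powr ((?n / ?m - e) * real k)"
    by (simp add: r_def powr_minus_divide[symmetric] algebra_simps)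
  have r16: "16 * r \<le> \<rho>"
    using k1 \<open>0 < r\<close> \<open>0 < \<rho>\<close> unfolding r_eq[symmetric] by (simp add: field_simps)
  have "\<rho>' \<le> r"
  proof -
    have "?n / ?m - e \<le> (1 + e) * v"
    proof -
      have "(1 + e) * v = v + e * v" "0 < e * v"
        using e(1) \<open>0 < v\<close> by (simp_all add: algebra_simps)
      then show ?thesis using v e(1) by linarith
    qed
    then have "real k * ((1 + e) * (- v)) \<le> real k * (e - ?n / ?m)"
      by (intro mult_left_mono) (auto simp: algebra_simps)
    then have "?Q k powr (- v) \<le> r"
      unfolding r_def powr_powr by (intro powr_mono) (auto simp: algebra_simps)
    moreover have "\<rho>' \<le> ?Q k powr (- v)" by (simp add: \<rho>'_def)
    ultimately show ?thesis by linarith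
  qed
  have big: "2 * 4 ^ CARD('m) * (\<rho> / \<rho>') powr s \<le> (\<rho> / (16 * r)) ^ CARD('m)"
  proof -
    define X where "X = (2 * \<rho>) powr s"
    define Y where "Y = (\<rho> / 16) ^ CARD('m)"
    have "0 < Y" using \<open>0 < \<rho>\<close> by (simp add: Y_def)
    have Y: "(16 / \<rho>) ^ CARD('m) = 1 / Y" by (simp add: Y_def power_divide)
    have "\<rho> / \<rho>' = (2 * \<rho>) * ?Q k powr v"
      by (simp add: \<rho>'_def powr_minus field_simps)
    then have l: "(\<rho> / \<rho>') powr s = X * 2 powr (real k * (1 + e) * (v * s))"
      using \<open>0 < \<rho>\<close> by (simp add: X_def powr_mult powr_powr algebra_simps)
    have "(\<rho> / (16 * r)) ^ CARD('m) = (\<rho> / 16 * (1 / r)) ^ CARD('m)" by simp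
    also have "\<dots> = Y * 2 powr (?m * ((?n / ?m - e) * real k))"
      unfolding power_mult_distrib Y_def r_eq by (simp add: powr_power mult.commute)
    also have "?m * ((?n / ?m - e) * real k) = \<sigma> * real k + real k * (1 + e) * (v * s)"
      using mn by (simp add: \<sigma>_def field_simps)
    finally have "(\<rho> / (16 * r)) ^ CARD('m) = Y * (2 powr (\<sigma> * real k) * 2 powr (real k * (1 + e) * (v * s)))"
      by (simp add: powr_add)
    moreover have "2 * 4 ^ CARD('m) * X \<le> Y * 2 powr (\<sigma> * real k)"
      using k2 \<open>0 < Y\<close> unfolding X_def[symmetric] Y by (simp add: field_simps)
    then have "2 * 4 ^ CARD('m) * X * 2 powr (real k * (1 + e) * (v * s))
        \<le> Y * 2 powr (\<sigma> * real k) * 2 powr (real k * (1 + e) * (v * s))"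
      by (intro mult_right_mono) auto
    ultimately show ?thesis unfolding l by (simp add: mult.assoc)
  qed
  obtain qq pp where qp: "\<And>b. qq b \<in> int_vecs" "\<And>b. pp b \<in> int_vecs"
    "\<And>b. infnorm (A *v qq b + pp b - b) \<le> r" "\<And>b. K \<le> infnorm (qq b)" "\<And>b. infnorm (qq b) \<le> ?Q k"
    using dense unfolding r_def by metis
  have "\<exists>b. infnorm ((A *v qq b + pp b) - z) + \<rho>' \<le> \<rho> \<and>
           (\<forall>J. finite J \<longrightarrow> (\<forall>i\<in>J. \<exists>x\<in>V i. infnorm (x - (A *v qq b + pp b)) \<le> \<rho>') \<longrightarrow>
                (\<Sum>i\<in>J. \<eta> i powr s) \<le> \<theta> * \<rho>' powr s)"
  proof (rule good_child_exists[OF s(1,2) V \<theta> _ \<open>0 < \<rho>'\<close> \<open>\<rho>' \<le> r\<close> r16 big qp(3)])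
    show "(\<Sum>i\<in>J. \<eta> i powr s) \<le> \<theta> * \<rho> powr s"
      if "finite J" "\<And>i. i \<in> J \<Longrightarrow> \<exists>x\<in>V i. infnorm (x - z) \<le> \<rho>" for J
      using light that unfolding light_def by blast
  qed
  then obtain b where b: "infnorm (A *v qq b + pp b - z) + \<rho>' \<le> \<rho>"
    "light V \<eta> s \<theta> (A *v qq b + pp b) \<rho>'"
    unfolding light_def by blast
  show thesis
  proof
    show "\<rho>' \<le> \<rho> / 2" using \<open>\<rho>' \<le> r\<close> r16 \<open>0 < r\<close> by linarith
    have "?Q k powr (- v) \<le> infnorm (qq b) powr (- v)"
      using qp(4,5)[of b] \<open>0 < K\<close> \<open>0 < v\<close> by (intro powr_mono2') auto
    moreover have "\<rho>' < ?Q k powr (- v)" by (simp add: \<rho>'_def)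
    ultimately show "\<rho>' < infnorm (qq b) powr (- v)" by linarith
  qed (fact qp b \<open>0 < \<rho>'\<close>)+
qed

text \<open>Iterating \<open>light_step\<close> from the ball around 0 gives nested balls with radii
  tending to 0. Their common point lies in every ball, hence is approximated by every
  \<open>A q + p\<close> that occurs, and is kept off each \<open>V i\<close> by lightness. The
  norms of the \<open>q\<close> increase strictly, so infinitely many distinct \<open>q\<close>
  occur.\<close>

lemma avoiding_point_exists:
  fixes A :: "real^'n^'m" and V :: "nat \<Rightarrow> (real^'m) set"
  assumes Delta: "\<And>e. 0 < e \<Longrightarrow> \<exists>\<^sub>F k in sequentially. 2 powr (- e * real k) \<le> Delta k A"
    and s: "0 < s" "s \<le> real CARD('m)" "v * s < real CARD('n)"
    and v: "real CARD('n) / real CARD('m) \<le> v"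
    and V: "\<And>i x y. x \<in> V i \<Longrightarrow> y \<in> V i \<Longrightarrow> infnorm (x - y) \<le> \<eta> i" "\<And>i. 0 < \<eta> i"
    and \<theta>: "0 < \<theta>" "\<theta> \<le> 1" "2 * 64 ^ CARD('m) * \<theta> \<le> 1"
    and "0 < \<rho>0" and small: "\<And>J. finite J \<Longrightarrow> (\<Sum>i\<in>J. \<eta> i powr s) \<le> \<theta> * \<rho>0 powr s"
  obtains x where "infnorm x \<le> \<rho>0" "\<And>i. x \<notin> V i"
    "infinite {q \<in> int_vecs. q \<noteq> 0 \<and> (\<exists>p\<in>int_vecs. infnorm (A *v q + p - x) < infnorm q powr (- v))}"
proof -
  define z :: "(real^'n) \<times> (real^'m) \<times> real \<Rightarrow> real^'m" where "z = (\<lambda>(q, p, \<rho>). A *v q + p)"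
  define \<rho> :: "(real^'n) \<times> (real^'m) \<times> real \<Rightarrow> real" where "\<rho> = (\<lambda>(q, p, \<rho>). \<rho>)"
  define good where "good y \<longleftrightarrow> 0 < \<rho> y \<and> light V \<eta> s \<theta> (z y) (\<rho> y)" for y
  define succ where "succ y y' \<longleftrightarrow> fst y' \<in> int_vecs \<and> fst (snd y') \<in> int_vecs \<and>
      \<rho> y' \<le> \<rho> y / 2 \<and> infnorm (z y' - z y) + \<rho> y' \<le> \<rho> y \<and> infnorm (fst y) + 1 \<le> infnorm (fst y') \<and>
      \<rho> y' < infnorm (fst y') powr (- v)" for y y'
  have "\<exists>Y. \<forall>n. (good (Y n) \<and> (n = 0 \<longrightarrow> Y n = (0, 0, \<rho>0))) \<and> succ (Y n) (Y (Suc n))"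
  proof (rule dependent_nat_choice)
    have "light V \<eta> s \<theta> 0 \<rho>0" unfolding light_def using small by blast
    then show "\<exists>y. good y \<and> (0 = (0::nat) \<longrightarrow> y = (0, 0, \<rho>0))"
      using \<open>0 < \<rho>0\<close> by (intro exI[of _ "(0, 0, \<rho>0)"]) (simp add: good_def z_def \<rho>_def)
  next
    fix y :: "(real^'n) \<times> (real^'m) \<times> real" and n :: nat
    assume "good y \<and> (n = 0 \<longrightarrow> y = (0, 0, \<rho>0))"
    then have y: "0 < \<rho> y" "light V \<eta> s \<theta> (z y) (\<rho> y)" by (auto simp: good_def)
    have "0 < infnorm (fst y) + 1" using infnorm_pos_le[of "fst y"] by linarith
    from light_step[OF Delta s v V \<theta> y(2,1) this]
    obtain q p \<rho>' where "q \<in> int_vecs" "p \<in> int_vecs" "light V \<eta> s \<theta> (A *v q + p) \<rho>'"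
      "0 < \<rho>'" "\<rho>' \<le> \<rho> y / 2" "infnorm (A *v q + p - z y) + \<rho>' \<le> \<rho> y" "infnorm (fst y) + 1 \<le> infnorm q"
      "\<rho>' < infnorm q powr (- v)"
      by metis
    then show "\<exists>y'. (good y' \<and> (Suc n = 0 \<longrightarrow> y' = (0, 0, \<rho>0))) \<and> succ y y'"
      by (intro exI[of _ "(q, p, \<rho>')"]) (simp add: good_def succ_def z_def \<rho>_def)
  qed
  then obtain Y where Y: "\<And>n. good (Y n)" "Y 0 = (0, 0, \<rho>0)" "\<And>n. succ (Y n) (Y (Suc n))"
    by blast
  have pos: "0 < \<rho> (Y n)" for n using Y(1) by (simp add: good_def)
  have \<rho>_le: "\<rho> (Y n) \<le> \<rho>0 * (1 / 2) ^ n" for n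
  proof (induction n)
    case (Suc n)
    then show ?case using Y(3)[of n] by (simp add: succ_def)
  qed (simp add: Y(2) \<rho>_def)
  have "(\<lambda>n. \<rho>0 * (1 / 2) ^ n) \<longlonglongrightarrow> \<rho>0 * 0"
    by (intro tendsto_intros LIMSEQ_power_zero) simp
  then have \<rho>_lim: "(\<lambda>n. \<rho> (Y n)) \<longlonglongrightarrow> 0"
    using \<rho>_le pos by (intro tendsto_sandwich[of "\<lambda>_. 0" "\<lambda>n. \<rho> (Y n)" sequentially "\<lambda>n. \<rho>0 * (1 / 2) ^ n" 0])
      (auto intro!: always_eventually less_imp_le)
  have nested: "infnorm (z (Y (n + k)) - z (Y n)) + \<rho> (Y (n + k)) \<le> \<rho> (Y n)" for n k
  proof (induction k)
    case 0
    show ?case by (simp add: infnorm_0)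
  next
    case (Suc k)
    then show ?case
      using Y(3)[of "n + k"] infnorm_minus_triangle[of "z (Y (Suc (n + k)))" "z (Y n)" "z (Y (n + k))"]
      by (simp add: succ_def)
  qed
  have "Cauchy (\<lambda>n. z (Y n))"
  proof (rule CauchyI')
    fix e :: real assume "0 < e"
    define c where "c = sqrt (real DIM(real^'m))"
    have "0 < c" by (simp add: c_def)
    have "\<forall>\<^sub>F n in sequentially. \<rho> (Y n) < e / c"
      using \<rho>_lim \<open>0 < e\<close> \<open>0 < c\<close> by (intro order_tendstoD(2)) auto
    then obtain N where N: "\<And>n. N \<le> n \<Longrightarrow> \<rho> (Y n) < e / c"
      unfolding eventually_sequentially by blast
    show "\<exists>M. \<forall>m\<ge>M. \<forall>n>m. dist (z (Y m)) (z (Y n)) < e"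
    proof (intro exI[of _ N] allI impI)
      fix m n assume "N \<le> m" "m < n"
      have "infnorm (z (Y n) - z (Y m)) \<le> \<rho> (Y m)"
        using nested[of m "n - m"] pos[of n] \<open>m < n\<close> by simp
      then have "norm (z (Y n) - z (Y m)) \<le> c * \<rho> (Y m)"
        using norm_le_infnorm[of "z (Y n) - z (Y m)"] \<open>0 < c\<close> mult_left_mono[of _ _ c]
        unfolding c_def[symmetric] by (smt (verit))
      also have "\<dots> < e" using N[OF \<open>N \<le> m\<close>] \<open>0 < c\<close> by (simp add: field_simps)
      finally show "dist (z (Y m)) (z (Y n)) < e" by (simp add: dist_norm norm_minus_commute)
    qed
  qed
  then obtain x where x: "(\<lambda>n. z (Y n)) \<longlonglongrightarrow> x"
    using Cauchy_convergent convergent_def by blast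
  have near: "infnorm (x - z (Y n)) \<le> \<rho> (Y n)" for n
  proof (rule LIMSEQ_le_const2)
    show "(\<lambda>k. infnorm (z (Y k) - z (Y n))) \<longlonglongrightarrow> infnorm (x - z (Y n))"
      by (intro tendsto_infnorm tendsto_diff x tendsto_const)
    have "infnorm (z (Y k) - z (Y n)) \<le> \<rho> (Y n)" if "n \<le> k" for k
      using nested[of n "k - n"] pos[of k] that by simp
    then show "\<exists>N. \<forall>k\<ge>N. infnorm (z (Y k) - z (Y n)) \<le> \<rho> (Y n)" by blast
  qed
  show thesis
  proof
    show "infnorm x \<le> \<rho>0" using near[of 0] by (simp add: Y(2) z_def \<rho>_def)
    show "x \<notin> V i" for i
    proof
      assume "x \<in> V i"
      then have "\<eta> i \<le> \<rho> (Y n)" for n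
        using Y(1)[of n] lightD[OF _ _ near pos s(1) \<theta>(2)] unfolding good_def by blast
      then have "\<eta> i \<le> 0" by (intro LIMSEQ_le_const[OF \<rho>_lim]) blast
      with V(2)[of i] show False by simp
    qed
    \<comment> \<open>Shifted by one: the initial state has \<open>q = 0\<close> and is no
      approximation; integrality and the radius bound hold for successor states.\<close>
    define q where "q n = fst (Y (Suc n))" for n
    have step: "infnorm (q n) < infnorm (q (Suc n))" for n
      using Y(3)[of "Suc n"] by (simp add: succ_def q_def)
    have "strict_mono (\<lambda>n. infnorm (q n))"
      using step by (rule strict_monoI_Suc)
    then have "inj q" by (metis (mono_tags, lifting) injI strict_mono_eq)
    moreover have "range q \<subseteq> {q \<in> int_vecs. q \<noteq> 0 \<and>
        (\<exists>p\<in>int_vecs. infnorm (A *v q + p - x) < infnorm q powr (- v))}"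
    proof safe
      fix n
      have Yn: "succ (Y n) (Y (Suc n))" by (rule Y(3))
      then show "q n \<in> int_vecs" by (simp add: succ_def q_def)
      show "q n = 0 \<Longrightarrow> False"
        using Yn infnorm_pos_le[of "fst (Y n)"] by (auto simp: succ_def q_def infnorm_0)
      define p where "p = fst (snd (Y (Suc n)))"
      have "z (Y (Suc n)) = A *v q n + p" by (simp add: z_def q_def p_def split_beta)
      moreover have "infnorm (z (Y (Suc n)) - x) \<le> \<rho> (Y (Suc n))"
        using near[of "Suc n"] by (metis infnorm_neg minus_diff_eq)
      ultimately have "infnorm (A *v q n + p - x) < infnorm (q n) powr (- v)"
        using Yn by (simp add: succ_def q_def)
      moreover have "p \<in> int_vecs" using Yn by (simp add: succ_def p_def)
      ultimately show "\<exists>p\<in>int_vecs. infnorm (A *v q n + p - x) < infnorm (q n) powr (- v)" by blast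
    qed
    ultimately show "infinite {q \<in> int_vecs. q \<noteq> 0 \<and>
        (\<exists>p\<in>int_vecs. infnorm (A *v q + p - x) < infnorm q powr (- v))}"
      using range_inj_infinite infinite_super by blast
  qed
qed

subsection \<open>Hausdorff dimension\<close>

lemma infnorm_int_vecs_ge_1:
  fixes q :: "real^'n"
  assumes "q \<in> int_vecs" "q \<noteq> 0"
  shows "1 \<le> infnorm q"
proof -
  obtain i where i: "q $ i \<noteq> 0" using assms(2) by (auto simp: vec_eq_iff)
  have "q $ i \<in> \<int>" using assms(1) by (simp add: int_vecs_def)
  then have "1 \<le> \<bar>q $ i\<bar>" using i by (rule Ints_nonzero_abs_ge1)
  then show ?thesis using component_le_infnorm_cart[of q i] by linarith
qed

text \<open>Any nonzero integer vector is at distance at least \<open>1 / 2\<close> from such an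
  \<open>x\<close>, so 0 is a nearest one. Hence small balls of \<open>real^'m\<close> embed
  isometrically in the torus.\<close>

lemma dist_int_eq_infnorm:
  fixes x :: "real^'m"
  assumes "infnorm x \<le> 1 / 2"
  shows "dist_int x = infnorm x"
proof (rule antisym)
  show "dist_int x \<le> infnorm x" using dist_int_le[of 0 x] by simp
  obtain p where p: "p \<in> int_vecs" "dist_int x = infnorm (x - p)"
    using dist_int_attained by blast
  show "infnorm x \<le> dist_int x"
  proof (cases "p = 0")
    case False
    then obtain i where i: "p $ i \<noteq> 0" by (auto simp: vec_eq_iff)
    have "p $ i \<in> \<int>" using p(1) by (simp add: int_vecs_def)
    then have "1 \<le> \<bar>p $ i\<bar>" using i by (rule Ints_nonzero_abs_ge1)
    moreover have "\<bar>x $ i\<bar> \<le> 1 / 2" using component_le_infnorm_cart[of x i] assms by linarith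
    moreover have "\<bar>(x - p) $ i\<bar> \<le> infnorm (x - p)" by (rule component_le_infnorm_cart)
    ultimately show ?thesis using assms p(2) by simp
  qed (simp add: p)
qed

lemma sum_le_if_suminf_ennreal_less:
  fixes a :: "nat \<Rightarrow> real"
  assumes "\<And>i. 0 \<le> a i" "0 \<le> t" "(\<Sum>i. ennreal (a i)) < ennreal t" "finite J"
  shows "(\<Sum>i\<in>J. a i) \<le> t"
proof -
  have "ennreal (\<Sum>i\<in>J. a i) = (\<Sum>i\<in>J. ennreal (a i))"
    using assms(1) by (simp add: sum_ennreal)
  also have "\<dots> \<le> (\<Sum>i. ennreal (a i))"
    using assms(4) by (intro sum_le_suminf) auto
  also have "\<dots> \<le> ennreal t" using assms(3) by simp
  finally show ?thesis using assms(2) by simp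
qed

text \<open>Vanishing measure would provide a cover of arbitrarily small \<open>s\<close>-mass. Its
  pullback to the ball of radius \<open>1 / 8\<close> around 0 is avoided by a point whose class
  belongs to \<open>W\<close>.\<close>

lemma hausdorff_measure_W_nonzero:
  fixes A :: "real^'n^'m"
  assumes Delta: "\<And>e. 0 < e \<Longrightarrow> \<exists>\<^sub>F k in sequentially. 2 powr (- e * real k) \<le> Delta k A"
    and s: "0 < s" "s \<le> real CARD('m)" "v * s < real CARD('n)"
    and v: "real CARD('n) / real CARD('m) \<le> v"
  shows "hausdorff_measure s (W A (\<lambda>q. q powr (- v))) \<noteq> 0"
proof
  let ?W = "W A (\<lambda>q. q powr (- v))"
  assume "hausdorff_measure s ?W = 0"
  then have zero: "hausdorff_content s 1 ?W = 0"
    unfolding hausdorff_measure_def by (metis SUP_upper greaterThan_iff le_zero_eq zero_less_one)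
  define \<theta> :: real where "\<theta> = 1 / (2 * 64 ^ CARD('m))"
  have \<theta>: "0 < \<theta>" "\<theta> \<le> 1" "2 * 64 ^ CARD('m) * \<theta> \<le> 1"
    by (simp_all add: \<theta>_def field_simps) (simp add: one_le_power order_trans[of _ "64 ^ CARD('m)"])
  \<comment> \<open>Half of the mass allowed for the starting radius \<open>1 / 8\<close>: one
    \<open>\<tau>\<close> for the diameters, one for the enlargement of the sets below.\<close>
  define \<tau> where "\<tau> = \<theta> * (1 / 8) powr s / 2"
  have "0 < \<tau>" using \<theta>(1) by (simp add: \<tau>_def)
  have "hausdorff_content s 1 ?W < ennreal \<tau>" using zero \<open>0 < \<tau>\<close> by simp
  then obtain U :: "nat \<Rightarrow> 'm torus set" where U: "?W \<subseteq> (\<Union>i. U i)" "\<And>i. bounded (U i)"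
    "(\<Sum>i. diam_power s (U i)) < ennreal \<tau>"
    unfolding hausdorff_content_def INF_less_iff by blast
  define a where "a i = (if U i = {} then 0 else diameter (U i) powr s)" for i
  have a: "0 \<le> a i" "diam_power s (U i) = ennreal (a i)" for i
    using s(1) by (simp_all add: a_def diam_power_def)
  \<comment> \<open>The geometric terms, of total \<open>\<tau>\<close>, make every size
    \<open>\<eta> i\<close> positive, also for empty sets and single points.\<close>
  define b where "b i = a i + \<tau> * (1 / 2) ^ Suc i" for i
  have b: "0 < b i" for i using a(1)[of i] \<open>0 < \<tau>\<close> by (simp add: b_def add_nonneg_pos)
  define \<eta> where "\<eta> i = b i powr (1 / s)" for i
  have \<eta>: "0 < \<eta> i" "\<eta> i powr s = b i" for i
    using b[of i] s(1) by (simp_all add: \<eta>_def powr_powr)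
  have small: "(\<Sum>i\<in>J. \<eta> i powr s) \<le> \<theta> * (1 / 8) powr s" if "finite J" for J
  proof -
    have "(\<Sum>i\<in>J. \<eta> i powr s) = (\<Sum>i\<in>J. a i) + \<tau> * (\<Sum>i\<in>J. (1 / 2) ^ Suc i)"
      by (simp only: \<eta>(2) b_def sum.distrib sum_distrib_left)
    moreover have "(\<Sum>i\<in>J. a i) \<le> \<tau>"
      using a(1) U(3) \<open>0 < \<tau>\<close> that unfolding a(2) by (intro sum_le_if_suminf_ennreal_less) auto
    moreover have "(\<Sum>i\<in>J. (1 / 2 :: real) ^ Suc i) \<le> 1"
      using that sum_le_suminf[OF sums_summable[OF power_half_series], of J]
      by (simp add: sums_unique[OF power_half_series, symmetric] del: power_Suc)
    then have "\<tau> * (\<Sum>i\<in>J. (1 / 2) ^ Suc i) \<le> \<tau> * 1"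
      using \<open>0 < \<tau>\<close> by (intro mult_left_mono) auto
    ultimately show ?thesis unfolding \<tau>_def by simp
  qed
  \<comment> \<open>Two points of this ball differ by at most \<open>1 / 4\<close>, so the torus
    distance of their classes is the supremum norm of the difference, and the diameter of
    \<open>U i\<close> bounds that of \<open>V i\<close>.\<close>
  define V :: "nat \<Rightarrow> (real^'m) set" where "V i = {x. infnorm x \<le> 1 / 8 \<and> torus_of x \<in> U i}" for i
  have V: "infnorm (x - y) \<le> \<eta> i" if "x \<in> V i" "y \<in> V i" for i x y
  proof -
    have "infnorm (x - y) \<le> infnorm x + infnorm y"
      using infnorm_triangle[of x "- y"] by (simp add: infnorm_neg)
    then have "infnorm (x - y) = dist (torus_of x) (torus_of y)"
      using that unfolding dist_torus_of by (intro dist_int_eq_infnorm[symmetric]) (simp add: V_def)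
    also have "\<dots> \<le> diameter (U i)"
      using that U(2) by (intro diameter_bounded_bound) (auto simp: V_def)
    also have "\<dots> = a i powr (1 / s)"
      using that s(1) diameter_ge_0[OF U(2)] by (auto simp: a_def V_def powr_powr)
    also have "\<dots> \<le> \<eta> i"
      unfolding \<eta>_def b_def using a(1) \<open>0 < \<tau>\<close> s(1) by (intro powr_mono2) auto
    finally show ?thesis .
  qed
  obtain x where x: "infnorm x \<le> 1 / 8" "\<And>i. x \<notin> V i"
    "infinite {q \<in> int_vecs. q \<noteq> 0 \<and> (\<exists>p\<in>int_vecs. infnorm (A *v q + p - x) < infnorm q powr (- v))}"
    by (rule avoiding_point_exists[OF Delta s v V \<eta>(1) \<theta> _ small]) auto
  have "{q \<in> int_vecs. q \<noteq> 0 \<and> (\<exists>p\<in>int_vecs. infnorm (A *v q + p - x) < infnorm q powr (- v))}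
      \<subseteq> {q \<in> int_vecs. q \<noteq> 0 \<and> dist (torus_of (A *v q)) (torus_of x) < infnorm q powr (- v)}"
  proof safe
    fix q p assume "p \<in> int_vecs" and less: "infnorm (A *v q + p - x) < infnorm q powr (- v)"
    have "dist (torus_of (A *v q)) (torus_of x) \<le> infnorm (A *v q - x - (- p))"
      unfolding dist_torus_of using \<open>p \<in> int_vecs\<close> by (intro dist_int_le int_vecs_uminus)
    also have "A *v q - x - (- p) = A *v q + p - x" by simp
    finally show "dist (torus_of (A *v q)) (torus_of x) < infnorm q powr (- v)" using less by simp
  qed
  then have "torus_of x \<in> ?W"
    unfolding W_def using x(3) infinite_super by blast
  then obtain i where "torus_of x \<in> U i" using U(1) by blast
  then have "x \<in> V i" using x(1) by (simp add: V_def)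
  with x(2) show False by blast
qed

section \<open>Covers by finite blocks and vanishing Hausdorff measure\<close>

lemma hausdorff_content_le_suminf:
  fixes F :: "nat \<Rightarrow> 'b set" and f :: "nat \<Rightarrow> 'b \<Rightarrow> 'a::metric_space set"
  assumes F: "\<And>k. finite (F k)" and cover: "E \<subseteq> (\<Union>k. \<Union>i\<in>F k. f k i)"
    and f: "\<And>k i. i \<in> F k \<Longrightarrow> bounded (f k i) \<and> diameter (f k i) \<le> \<delta>" and "0 \<le> \<delta>"
    and c: "\<And>k i. i \<in> F k \<Longrightarrow> diam_power s (f k i) \<le> c k"
  shows "hausdorff_content s \<delta> E \<le> (\<Sum>k. of_nat (card (F k)) * c k)"
proof -
  obtain e where e: "\<And>k. bij_betw (e k) {0..<card (F k)} (F k)"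
    using ex_bij_betw_nat_finite[OF F] by metis
  \<comment> \<open>Each block is padded to an infinite sequence by empty sets, which cost nothing
    because \<open>diam_power\<close> is 0 there even for \<open>s = 0\<close>;
    \<open>prod_decode\<close> then lists the double sequence.\<close>
  define u where "u = (\<lambda>(k, j). if j < card (F k) then f k (e k j) else {})"
  have e_in: "e k j \<in> F k" if "j < card (F k)" for k j
    using e[of k] that by (auto simp: bij_betw_def)
  have "hausdorff_content s \<delta> E \<le> (\<Sum>n. diam_power s (u (prod_decode n)))"
    unfolding hausdorff_content_def
  proof (rule INF_lower, intro CollectI conjI allI)
    show "E \<subseteq> (\<Union>n. u (prod_decode n))"
    proof
      fix x assume "x \<in> E"
      then obtain k i where ki: "i \<in> F k" "x \<in> f k i" using cover by blast
      have "i \<in> e k ` {0..<card (F k)}" using e[of k] ki(1) by (simp add: bij_betw_def)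
      then obtain j where "j < card (F k)" "i = e k j" by auto
      then have "x \<in> u (prod_decode (prod_encode (k, j)))" using ki by (simp add: u_def)
      then show "x \<in> (\<Union>n. u (prod_decode n))" by blast
    qed
    fix n
    obtain k j where "prod_decode n = (k, j)" by force
    then show "bounded (u (prod_decode n))" "diameter (u (prod_decode n)) \<le> \<delta>"
      using f[OF e_in] \<open>0 \<le> \<delta>\<close> by (auto simp: u_def)
  qed
  also have "\<dots> = (\<Sum>k. \<Sum>j. diam_power s (u (k, j)))"
    by (rule suminf_ennreal_2dimen) simp
  also have "\<dots> \<le> (\<Sum>k. of_nat (card (F k)) * c k)"
  proof (rule suminf_le)
    fix k
    have "(\<Sum>j. diam_power s (u (k, j))) = (\<Sum>j\<in>{0..<card (F k)}. diam_power s (u (k, j)))"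
      by (rule suminf_finite) (auto simp: u_def diam_power_def)
    also have "\<dots> \<le> (\<Sum>j\<in>{0..<card (F k)}. c k)"
      using c[OF e_in] by (intro sum_mono) (auto simp: u_def)
    finally show "(\<Sum>j. diam_power s (u (k, j))) \<le> of_nat (card (F k)) * c k" by simp
  qed auto
  finally show ?thesis .
qed

lemma diameter_cball_le:
  fixes x :: "'a::metric_space"
  assumes "0 \<le> r"
  shows "diameter (cball x r) \<le> 2 * r"
proof -
  have "dist y z \<le> 2 * r" if "y \<in> cball x r" "z \<in> cball x r" for y z
    using that dist_triangle3[of y z x] by simp
  then show ?thesis
    using assms unfolding diameter_def by (auto intro!: cSUP_least)
qed

lemma diam_power_cball_le:
  fixes x :: "'a::metric_space"
  assumes "0 \<le> r" "r \<le> R" "0 < s"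
  shows "diam_power s (cball x r) \<le> ennreal ((2 * R) powr s)"
proof -
  have "diameter (cball x r) powr s \<le> (2 * R) powr s"
    using diameter_cball_le[OF assms(1), of x] assms
    by (intro powr_mono2 diameter_ge_0 bounded_cball) auto
  then show ?thesis
    using assms by (auto simp: diam_power_def intro!: ennreal_leI)
qed

lemma card_int_vecs_le:
  assumes "0 \<le> B"
  shows "finite {q :: real^'n. q \<in> int_vecs \<and> infnorm q \<le> B}"
    and "real (card {q :: real^'n. q \<in> int_vecs \<and> infnorm q \<le> B}) \<le> (2 * B + 1) ^ CARD('n)"
proof -
  let ?S = "{q :: real^'n. q \<in> int_vecs \<and> infnorm q \<le> B}"
  let ?P = "Pi\<^sub>E (UNIV :: 'n set) (\<lambda>_. {- \<lfloor>B\<rfloor>..\<lfloor>B\<rfloor>})"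
  have "finite ?P" by (intro finite_PiE) auto
  have sub: "?S \<subseteq> (\<lambda>u. \<chi> i. of_int (u i)) ` ?P"
  proof
    fix q assume q: "q \<in> ?S"
    have "q = (\<chi> i. of_int \<lfloor>q $ i\<rfloor>)"
      using q by (simp add: vec_eq_iff int_vecs_def)
    moreover have "\<lfloor>q $ i\<rfloor> \<in> {- \<lfloor>B\<rfloor>..\<lfloor>B\<rfloor>}" for i
    proof -
      have "q $ i \<in> \<int>" using q by (simp add: int_vecs_def)
      then obtain k where k: "q $ i = of_int k" by (rule Ints_cases)
      have "\<bar>q $ i\<bar> \<le> B" using q component_le_infnorm_cart[of q i] by simp
      then have "of_int k \<le> B" "of_int (- k) \<le> B" by (simp_all add: k)
      then have "k \<le> \<lfloor>B\<rfloor>" "- k \<le> \<lfloor>B\<rfloor>" by (simp_all only: le_floor_iff)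
      then show ?thesis by (simp add: k)
    qed
    then have "(\<lambda>i. \<lfloor>q $ i\<rfloor>) \<in> ?P" by auto
    ultimately show "q \<in> (\<lambda>u. \<chi> i. of_int (u i)) ` ?P" by (rule image_eqI)
  qed
  then show "finite ?S" using \<open>finite ?P\<close> by (rule finite_subset[OF _ finite_imageI])
  have "card ?S \<le> card ?P"
    using surj_card_le[OF \<open>finite ?P\<close> sub] .
  then have "real (card ?S) \<le> real (card ?P)" by simp
  also have "\<dots> = (2 * of_int \<lfloor>B\<rfloor> + 1) ^ CARD('n)"
    using assms by (simp add: card_PiE)
  also have "\<dots> \<le> (2 * B + 1) ^ CARD('n)"
    using assms by (intro power_mono) auto
  finally show "real (card ?S) \<le> (2 * B + 1) ^ CARD('n)" .
qed

lemma ennreal_zero_if_le_null_sequence: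
  fixes x :: ennreal
  assumes "\<forall>\<^sub>F k in sequentially. x \<le> ennreal (g k)" "g \<longlonglongrightarrow> 0"
  shows "x = 0"
proof -
  have "(\<lambda>k. ennreal (g k)) \<longlonglongrightarrow> ennreal 0" using assms(2) by (rule tendsto_ennrealI)
  then have "x \<le> ennreal 0"
    using assms(1) by (rule tendsto_lowerbound) simp
  then show ?thesis by simp
qed

lemma hausdorff_measure_mono:
  assumes "E \<subseteq> E'"
  shows "hausdorff_measure s E \<le> hausdorff_measure s E'"
  unfolding hausdorff_measure_def hausdorff_content_def
  using assms by (intro SUP_mono INF_superset_mono bexI) auto

lemma hausdorff_measure_empty: "hausdorff_measure s {} = 0"
proof -
  have "hausdorff_content s \<delta> {} = 0" if "0 < \<delta>" for \<delta>
    using hausdorff_content_le_suminf[of "\<lambda>_. {}" "{}" "\<lambda>_ _. {}" \<delta> s "\<lambda>_. 0"] that by simp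
  then show ?thesis unfolding hausdorff_measure_def by (intro antisym SUP_least) auto
qed

text \<open>A grid of mesh \<open>1 / Suc N\<close> covers the torus by on the order of
  \<open>N ^ m\<close> balls of that radius, with total \<open>s\<close>-mass on the order of
  \<open>N powr (m - s)\<close>, which tends to 0.\<close>

lemma hausdorff_measure_torus_eq_0:
  fixes E :: "'m::finite torus set"
  assumes "real CARD('m) < s"
  shows "hausdorff_measure s E = 0"
proof -
  have "0 < s" using assms by (meson le_less_trans of_nat_0_le_iff)
  have "hausdorff_content s \<delta> E = 0" if "0 < \<delta>" for \<delta>
  proof (rule ennreal_zero_if_le_null_sequence)
    let ?g = "\<lambda>N. (2 * (real (Suc N) + 1) + 1) ^ CARD('m) * (2 * (1 / real (Suc N))) powr s"
    have "\<forall>\<^sub>F N in sequentially. 2 / real (Suc N) < \<delta>"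
      using that by (intro order_tendstoD(2)[of _ 0] LIMSEQ_Suc[OF lim_const_over_n]) auto
    then show "\<forall>\<^sub>F N in sequentially. hausdorff_content s \<delta> E \<le> ennreal (?g N)"
    proof (rule eventually_mono)
      fix N assume N: "2 / real (Suc N) < \<delta>"
      define R where "R = 1 / real (Suc N)"
      have "0 < R" by (simp add: R_def)
      let ?F = "{q :: real^'m. q \<in> int_vecs \<and> infnorm q \<le> real (Suc N) + 1}"
      have fin: "finite ?F" by (rule card_int_vecs_le) simp
      \<comment> \<open>A single finite cover, regarded as a block family in which only block 0 is
        nonempty.\<close>
      have "hausdorff_content s \<delta> E \<le>
          (\<Sum>k. of_nat (card (if k = 0 then ?F else {})) * ennreal ((2 * R) powr s))"
      proof (rule hausdorff_content_le_suminf[where f = "\<lambda>k q. cball (torus_of (R *\<^sub>R q)) R"])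
        show "E \<subseteq> (\<Union>k. \<Union>q\<in>(if k = (0::nat) then ?F else {}). cball (torus_of (R *\<^sub>R q)) R)"
        proof
          fix y assume "y \<in> E"
          have "\<exists>x. y = torus_of x" by (induction y rule: torus.abs_induct) blast
          then obtain x where x: "y = torus_of x" by blast
          define x' where "x' = (\<chi> i. frac (x $ i))"
          define q :: "real^'m" where "q = (\<chi> i. of_int \<lfloor>x' $ i / R\<rfloor>)"
          have "x - x' \<in> int_vecs" by (simp add: x'_def int_vecs_def frac_def)
          then have y: "y = torus_of x'" unfolding x torus.abs_eq_iff .
          have x'01: "0 \<le> x' $ i" "x' $ i \<le> 1" for i by (simp_all add: x'_def frac_ge_0 less_imp_le frac_lt_1)
          have "infnorm q \<le> real (Suc N) + 1"
          proof (rule infnorm_le_cart)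
            fix i
            have "0 \<le> x' $ i / R" "x' $ i / R \<le> real (Suc N)"
              using x'01[of i] \<open>0 < R\<close> by (simp_all add: R_def mult_left_le_one_le)
            moreover from this have "0 \<le> \<lfloor>x' $ i / R\<rfloor>" by simp
            ultimately show "\<bar>q $ i\<bar> \<le> real (Suc N) + 1"
              unfolding q_def vec_lambda_beta by linarith
          qed
          then have "q \<in> ?F" by (simp add: q_def int_vecs_def)
          moreover have "y \<in> cball (torus_of (R *\<^sub>R q)) R"
          proof -
            have "dist_int (R *\<^sub>R q - x') \<le> infnorm (R *\<^sub>R q - x' - 0)" by (rule dist_int_le) simp
            also have "\<dots> \<le> R"
            proof (rule infnorm_le_cart)
              fix i
              have "(R *\<^sub>R q - x' - 0) $ i = R * (of_int \<lfloor>x' $ i / R\<rfloor> - x' $ i / R)"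
                using \<open>0 < R\<close> by (simp add: q_def field_simps)
              also have "\<bar>\<dots>\<bar> \<le> R * 1"
                unfolding abs_mult using \<open>0 < R\<close> by (intro mult_mono) (simp_all, linarith)
              finally show "\<bar>(R *\<^sub>R q - x' - 0) $ i\<bar> \<le> R" by simp
            qed
            finally show ?thesis by (simp add: y dist_torus_of)
          qed
          ultimately show "y \<in> (\<Union>k. \<Union>q\<in>(if k = (0::nat) then ?F else {}). cball (torus_of (R *\<^sub>R q)) R)"
            by (intro UN_I[of "0::nat"] UN_I[of q]) simp_all
        qed
        show "bounded (cball (torus_of (R *\<^sub>R q)) R) \<and> diameter (cball (torus_of (R *\<^sub>R q)) R) \<le> \<delta>" for q :: "real^'m"
          using diameter_cball_le[of R "torus_of (R *\<^sub>R q)"] \<open>0 < R\<close> N by (simp add: R_def)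
        show "diam_power s (cball (torus_of (R *\<^sub>R q)) R) \<le> ennreal ((2 * R) powr s)" for q :: "real^'m"
          using \<open>0 < R\<close> \<open>0 < s\<close> by (intro diam_power_cball_le) auto
      qed (use fin that in auto)
      also have "\<dots> = of_nat (card ?F) * ennreal ((2 * R) powr s)"
        by (subst suminf_finite[of "{0}"]) auto
      also have "\<dots> = ennreal (real (card ?F) * (2 * R) powr s)"
        by (simp add: ennreal_mult ennreal_of_nat_eq_real_of_nat)
      also have "\<dots> \<le> ennreal (?g N)"
        using card_int_vecs_le(2)[of "real (Suc N) + 1", where 'n = 'm]
        by (intro ennreal_leI mult_mono) (auto simp: R_def)
      finally show "hausdorff_content s \<delta> E \<le> ennreal (?g N)" .
    qed
    show "?g \<longlonglongrightarrow> 0"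
    proof (rule tendsto_sandwich[where f = "\<lambda>_. 0"])
      let ?h = "\<lambda>N. 5 ^ CARD('m) * 2 powr s * real (Suc N) powr (real CARD('m) - s)"
      show "\<forall>\<^sub>F N in sequentially. ?g N \<le> ?h N"
      proof (rule always_eventually, rule allI)
        fix N
        have "(2 * (real (Suc N) + 1) + 1) ^ CARD('m) \<le> (5 * real (Suc N)) ^ CARD('m)"
          by (intro power_mono) auto
        also have "\<dots> = 5 ^ CARD('m) * real (Suc N) powr real CARD('m)"
          by (subst powr_realpow, simp, rule power_mult_distrib)
        finally have "?g N \<le> 5 ^ CARD('m) * real (Suc N) powr real CARD('m) * (2 * (1 / real (Suc N))) powr s"
          by (intro mult_right_mono) auto
        also have "\<dots> = ?h N"
        proof -
          have "5 ^ CARD('m) * y powr real CARD('m) * (2 * (1 / y)) powr s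
              = 5 ^ CARD('m) * 2 powr s * y powr (real CARD('m) - s)" if "0 < y" for y :: real
            using that by (simp add: powr_diff powr_divide)
          from this[of "real (Suc N)"] show ?thesis by simp
        qed
        finally show "?g N \<le> ?h N" .
      qed
      have "(\<lambda>N. real (Suc N) powr (real CARD('m) - s)) \<longlonglongrightarrow> 0"
        using assms by (intro LIMSEQ_Suc[of "\<lambda>N. real N powr (real CARD('m) - s)"]
            tendsto_neg_powr filterlim_real_sequentially) auto
      then show "?h \<longlonglongrightarrow> 0" by (rule tendsto_mult_right_zero)
    qed (auto intro!: always_eventually)
  qed
  then show ?thesis unfolding hausdorff_measure_def by (intro antisym SUP_least) auto
qed

text \<open>Each point of \<open>W\<close> has an approximation with \<open>|q| > 2 ^ K\<close>, so
  for every \<open>K\<close> the balls belonging to the dyadic shells from \<open>K\<close> on form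
  a cover. Shell \<open>j\<close> has on the order of \<open>2 powr (n j)\<close> balls of radius at
  most \<open>2 powr (- v j)\<close>; the masses form a geometric series with ratio
  \<open>2 powr (n - v s) < 1\<close>, whose tail vanishes as \<open>K\<close> grows.\<close>

lemma hausdorff_measure_W_eq_0:
  fixes A :: "real^'n^'m"
  assumes "0 < v" "real CARD('n) / v < s"
  shows "hausdorff_measure s (W A (\<lambda>q. q powr (- v))) = 0"
proof -
  let ?W = "W A (\<lambda>q. q powr (- v))"
  have "0 < s" using assms by (meson divide_nonneg_pos le_less_trans of_nat_0_le_iff)
  have vs: "real CARD('n) < v * s" using assms by (simp add: field_simps)
  define x where "x = 2 powr (real CARD('n) - v * s)"
  have x: "0 < x" "x < 1" using vs by (simp_all add: x_def powr_less_one)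
  \<comment> \<open>\<open>8 ^ n\<close> comes from counting the integer vectors of a shell,
    \<open>2 powr s\<close> from passing from radius to diameter.\<close>
  define C where "C = 8 ^ CARD('n) * 2 powr s"
  have "0 < C" by (simp add: C_def)
  have "hausdorff_content s \<delta> ?W = 0" if "0 < \<delta>" for \<delta>
  proof (rule ennreal_zero_if_le_null_sequence)
    let ?g = "\<lambda>K. C * x ^ K / (1 - x)"
    have "\<forall>\<^sub>F K in sequentially. 2 / \<delta> \<le> 2 powr (v * real K)"
      by (rule two_powr_eventually_ge) fact
    then show "\<forall>\<^sub>F K in sequentially. hausdorff_content s \<delta> ?W \<le> ennreal (?g K)"
    proof (rule eventually_mono)
      fix K assume K: "2 / \<delta> \<le> 2 powr (v * real K)"
      let ?F = "\<lambda>k. {q :: real^'n. q \<in> int_vecs \<and> 2 ^ (K + k) \<le> infnorm q \<and> infnorm q < 2 ^ Suc (K + k)}"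
      define R where "R k = 2 powr (- v * real (K + k))" for k
      have R: "infnorm q powr (- v) \<le> R k" if "q \<in> ?F k" for q k
      proof -
        have "infnorm q powr (- v) \<le> (2 ^ (K + k)) powr (- v)"
          using that \<open>0 < v\<close> by (intro powr_mono2') auto
        also have "\<dots> = R k" by (simp add: R_def powr_powr mult.commute flip: powr_realpow)
        finally show ?thesis .
      qed
      have fin: "finite (?F k)" and card: "real (card (?F k)) \<le> (8 * 2 ^ (K + k)) ^ CARD('n)" for k
      proof -
        let ?G = "{q :: real^'n. q \<in> int_vecs \<and> infnorm q \<le> 2 ^ Suc (K + k)}"
        have sub: "?F k \<subseteq> ?G" by auto
        have finG: "finite ?G" by (rule card_int_vecs_le) simp
        then show "finite (?F k)" using sub by (rule rev_finite_subset)
        have "real (card (?F k)) \<le> real (card ?G)" using card_mono[OF finG sub] by simp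
        also have "\<dots> \<le> (2 * 2 ^ Suc (K + k) + 1) ^ CARD('n)" by (rule card_int_vecs_le) simp
        also have "\<dots> \<le> (8 * 2 ^ (K + k)) ^ CARD('n)"
        proof (rule power_mono)
          have "(1::real) \<le> 2 ^ (K + k)" by (rule one_le_power) simp
          then show "2 * 2 ^ Suc (K + k) + 1 \<le> 8 * (2::real) ^ (K + k)"
            unfolding power_Suc by linarith
        qed simp
        finally show "real (card (?F k)) \<le> (8 * 2 ^ (K + k)) ^ CARD('n)" .
      qed
      have "hausdorff_content s \<delta> ?W \<le> (\<Sum>k. of_nat (card (?F k)) * ennreal ((2 * R k) powr s))"
      proof (rule hausdorff_content_le_suminf[where f = "\<lambda>k q. cball (torus_of (A *v q)) (infnorm q powr (- v))"])
        show "?W \<subseteq> (\<Union>k. \<Union>q\<in>?F k. cball (torus_of (A *v q)) (infnorm q powr (- v)))"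
        proof
          fix b assume "b \<in> ?W"
          then have inf: "infinite {q \<in> int_vecs. q \<noteq> 0 \<and> dist (torus_of (A *v q)) b < infnorm q powr (- v)}"
            by (simp add: W_def)
          have "finite {q :: real^'n. q \<in> int_vecs \<and> infnorm q \<le> 2 ^ K}"
            by (rule card_int_vecs_le) simp
          then have "\<not> {q \<in> int_vecs. q \<noteq> 0 \<and> dist (torus_of (A *v q)) b < infnorm q powr (- v)}
              \<subseteq> {q. q \<in> int_vecs \<and> infnorm q \<le> 2 ^ K}"
            using inf finite_subset by blast
          then obtain q where q: "q \<in> int_vecs" "2 ^ K < infnorm q"
            "dist (torus_of (A *v q)) b < infnorm q powr (- v)"
            unfolding subset_iff mem_Collect_eq by (meson not_le)
          obtain j where j: "infnorm q < 2 ^ j" using real_arch_pow[of 2 "infnorm q"] by auto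
          define k where "k = (LEAST k. infnorm q < 2 ^ Suc (K + k))"
          have "infnorm q < 2 ^ Suc (K + j)"
            using j by (rule less_le_trans) (intro power_increasing, auto)
          then have k: "infnorm q < 2 ^ Suc (K + k)" unfolding k_def by (rule LeastI)
          have "2 ^ (K + k) \<le> infnorm q"
          proof (cases k)
            case 0
            then show ?thesis using q(2) by simp
          next
            case (Suc k')
            then have "\<not> infnorm q < 2 ^ Suc (K + k')"
              using not_less_Least[of k' "\<lambda>k. infnorm q < 2 ^ Suc (K + k)"] by (simp add: k_def)
            then show ?thesis by (simp add: Suc)
          qed
          then show "b \<in> (\<Union>k. \<Union>q\<in>?F k. cball (torus_of (A *v q)) (infnorm q powr (- v)))"
            using q k by (intro UN_I[of k] UN_I[of q]) auto
        qed
        show "bounded (cball (torus_of (A *v q)) (infnorm q powr (- v))) \<and>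
            diameter (cball (torus_of (A *v q)) (infnorm q powr (- v))) \<le> \<delta>" if "q \<in> ?F k" for k q
        proof
          have "diameter (cball (torus_of (A *v q)) (infnorm q powr (- v))) \<le> 2 * infnorm q powr (- v)"
            by (rule diameter_cball_le) simp
          also have "\<dots> \<le> 2 * R k" using R[OF that] by simp
          also have "\<dots> \<le> 2 * 2 powr (- (v * real K))"
            using \<open>0 < v\<close> by (simp add: R_def algebra_simps)
          also have "\<dots> \<le> \<delta>"
            using K \<open>0 < \<delta>\<close> by (simp add: powr_minus field_simps)
          finally show "diameter (cball (torus_of (A *v q)) (infnorm q powr (- v))) \<le> \<delta>" .
        qed simp
        show "diam_power s (cball (torus_of (A *v q)) (infnorm q powr (- v))) \<le> ennreal ((2 * R k) powr s)"
          if "q \<in> ?F k" for k q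
          using R[OF that] \<open>0 < s\<close> by (intro diam_power_cball_le) auto
      qed (use fin \<open>0 < \<delta>\<close> in auto)
      also have "\<dots> \<le> (\<Sum>k. ennreal (C * x ^ (K + k)))"
      proof (rule suminf_le)
        fix k
        have "of_nat (card (?F k)) * ennreal ((2 * R k) powr s) = ennreal (real (card (?F k)) * (2 * R k) powr s)"
          by (simp add: ennreal_mult ennreal_of_nat_eq_real_of_nat)
        also have "\<dots> \<le> ennreal ((8 * 2 ^ (K + k)) ^ CARD('n) * (2 * R k) powr s)"
          using card by (intro ennreal_leI mult_right_mono) auto
        also have "(8 * 2 ^ (K + k)) ^ CARD('n) * (2 * R k) powr s = C * x ^ (K + k)"
        proof -
          have "(8 * 2 ^ (K + k)) ^ CARD('n) = 8 ^ CARD('n) * 2 powr (real CARD('n) * real (K + k))"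
            by (simp add: power_mult_distrib powr_realpow[symmetric] powr_powr powr_power mult.commute)
          moreover have "(2 * R k) powr s = 2 powr s * 2 powr (- (v * s) * real (K + k))"
            by (simp add: R_def powr_mult powr_powr algebra_simps)
          moreover have "2 powr (real CARD('n) * real (K + k)) * 2 powr (- (v * s) * real (K + k)) = x ^ (K + k)"
            unfolding x_def powr_add[symmetric] by (simp add: powr_power algebra_simps)
          ultimately show ?thesis by (simp only: C_def mult_ac)
        qed
        finally show "of_nat (card (?F k)) * ennreal ((2 * R k) powr s) \<le> ennreal (C * x ^ (K + k))" .
      qed auto
      also have "\<dots> = ennreal (\<Sum>k. C * x ^ K * x ^ k)"
        using x \<open>0 < C\<close> by (subst suminf_ennreal2) (auto simp: power_add mult.assoc intro!: summable_mult summable_geometric)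
      also have "(\<Sum>k. C * x ^ K * x ^ k) = ?g K"
        using x by (subst suminf_mult) (auto simp: suminf_geometric summable_geometric)
      finally show "hausdorff_content s \<delta> ?W \<le> ennreal (?g K)" .
    qed
    have "(\<lambda>K. C / (1 - x) * x ^ K) \<longlonglongrightarrow> 0"
      using x by (intro tendsto_mult_right_zero LIMSEQ_power_zero) auto
    then show "?g \<longlonglongrightarrow> 0" by simp
  qed
  then show ?thesis unfolding hausdorff_measure_def by (intro antisym SUP_least) auto
qed

section \<open>The dimension formula\<close>

lemma hausdorff_dim_le:
  assumes "0 \<le> t" "\<And>s. t < s \<Longrightarrow> hausdorff_measure s E = 0"
  shows "hausdorff_dim E \<le> ereal t"
proof (rule ereal_le_epsilon2)
  fix e :: real assume "0 < e"
  then show "hausdorff_dim E \<le> ereal t + ereal e"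
    unfolding hausdorff_dim_def using assms by (intro INF_lower2[of "t + e"]) auto
qed

text \<open>For exponent 0 every nonempty covering set counts 1. This settles \<open>s = 0\<close>,
  which the avoidance argument with its positive \<open>s\<close> does not reach.\<close>

lemma empty_if_hausdorff_measure_0_eq_0:
  assumes "hausdorff_measure 0 E = 0"
  shows "E = {}"
proof (rule ccontr)
  assume "E \<noteq> {}"
  have "hausdorff_content 0 1 E = 0"
    using assms unfolding hausdorff_measure_def by (metis SUP_upper greaterThan_iff le_zero_eq zero_less_one)
  then have "hausdorff_content 0 1 E < 1" by simp
  then obtain U where U: "E \<subseteq> (\<Union>i::nat. U i)" "(\<Sum>i. diam_power 0 (U i)) < 1"
    unfolding hausdorff_content_def INF_less_iff by blast
  obtain i where "U i \<noteq> {}" using U(1) \<open>E \<noteq> {}\<close> by blast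
  then have "1 = (\<Sum>i\<in>{i}. diam_power 0 (U i))" by (simp add: diam_power_def)
  also have "\<dots> \<le> (\<Sum>i. diam_power 0 (U i))" by (intro sum_le_suminf) auto
  finally show False using U(2) by (simp add: not_le[symmetric])
qed

lemma hausdorff_dim_W:
  fixes A :: "real^'n^'m"
  assumes Delta: "\<And>e. 0 < e \<Longrightarrow> \<exists>\<^sub>F k in sequentially. 2 powr (- e * real k) \<le> Delta k A"
    and "0 < v"
  shows "hausdorff_dim (W A (\<lambda>q. q powr (- v))) = ereal (min (real CARD('m)) (real CARD('n) / v))"
proof (rule antisym)
  let ?W = "\<lambda>v. W A (\<lambda>q. q powr (- v))"
  let ?d = "min (real CARD('m)) (real CARD('n) / v)"
  have mn: "0 < real CARD('m)" "0 < real CARD('n)" by simp_all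
  have "0 < ?d" using mn \<open>0 < v\<close> by simp
  show "hausdorff_dim (?W v) \<le> ereal ?d"
  proof (rule hausdorff_dim_le)
    show "0 \<le> ?d" using \<open>0 < ?d\<close> by simp
    show "hausdorff_measure s (?W v) = 0" if "?d < s" for s
    proof -
      consider "real CARD('m) < s" | "real CARD('n) / v < s"
        using \<open>?d < s\<close> unfolding min_less_iff_disj by blast
      then show ?thesis
        by cases (auto intro: hausdorff_measure_torus_eq_0 hausdorff_measure_W_eq_0 \<open>0 < v\<close>)
    qed
  qed
  have nonzero: "hausdorff_measure s (?W v) \<noteq> 0" if s: "0 < s" "s < ?d" for s
  proof
    \<comment> \<open>Since \<open>|q| \<ge> 1\<close>, enlarging \<open>v\<close> to
      \<open>w\<close> shrinks \<open>W\<close>, while \<open>min m (n / w) = min m (n / v)\<close>;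
      so nothing is lost by assuming \<open>v \<ge> n / m\<close>.\<close>
    define w where "w = max v (real CARD('n) / real CARD('m))"
    have "W A (\<lambda>q. q powr (- w)) \<subseteq> ?W v"
      unfolding W_def
    proof (intro Collect_mono impI)
      fix b
      assume inf: "infinite {q \<in> int_vecs. q \<noteq> 0 \<and> dist (torus_of (A *v q)) b < infnorm q powr - w}"
      have "infnorm q powr - w \<le> infnorm q powr - v" if "q \<in> int_vecs" "q \<noteq> 0" for q :: "real^'n"
        using infnorm_int_vecs_ge_1[OF that] by (intro powr_mono) (simp_all add: w_def)
      then have "{q \<in> int_vecs. q \<noteq> 0 \<and> dist (torus_of (A *v q)) b < infnorm q powr - w} \<subseteq>
          {q \<in> int_vecs. q \<noteq> 0 \<and> dist (torus_of (A *v q)) b < infnorm q powr - v}"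
        using less_le_trans by blast
      with inf show "infinite {q \<in> int_vecs. q \<noteq> 0 \<and> dist (torus_of (A *v q)) b < infnorm q powr - v}"
        using infinite_super by blast
    qed
    moreover assume "hausdorff_measure s (?W v) = 0"
    ultimately have "hausdorff_measure s (?W w) = 0"
      using hausdorff_measure_mono by (metis le_zero_eq)
    moreover have "hausdorff_measure s (?W w) \<noteq> 0"
    proof (rule hausdorff_measure_W_nonzero[OF Delta s(1)])
      show "s \<le> real CARD('m)" using s(2) by simp
      show "real CARD('n) / real CARD('m) \<le> w" by (simp add: w_def)
      show "w * s < real CARD('n)"
        using s \<open>0 < v\<close> mn by (auto simp: w_def max_def field_simps)
    qed
    ultimately show False by simp
  qed
  show "ereal ?d \<le> hausdorff_dim (?W v)"
    unfolding hausdorff_dim_def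
  proof (rule INF_greatest, clarify)
    fix s assume s: "0 \<le> s" "hausdorff_measure s (?W v) = 0"
    show "ereal ?d \<le> ereal s"
    proof (rule ccontr)
      assume "\<not> ereal ?d \<le> ereal s"
      then have "s < ?d" by (simp only: ereal_less_eq not_le)
      show False
      \<comment> \<open>Measure zero at exponent 0 would make \<open>W\<close> empty and hence null
        at every exponent, in particular at \<open>?d / 2\<close>, where \<open>nonzero\<close>
        applies.\<close>
      proof (cases "s = 0")
        case True
        then have "?W v = {}" using s(2) empty_if_hausdorff_measure_0_eq_0 by blast
        then have "hausdorff_measure (?d / 2) (?W v) = 0" using hausdorff_measure_empty by simp
        moreover have "0 < x / 2 \<and> x / 2 < x" if "0 < x" for x :: real using that by simp
        from this[OF \<open>0 < ?d\<close>] have "hausdorff_measure (?d / 2) (?W v) \<noteq> 0" by (intro nonzero) auto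
        ultimately show False by blast
      next
        case False
        then show False using nonzero[of s] s \<open>s < ?d\<close> by simp
      qed
    qed
  qed
qed

section \<open>Lower bounds for \<open>Delta\<close> from divergence and from nonsingularity\<close>

lemma Delta_nonneg:
  fixes A :: "real^'n^'m"
  shows "0 \<le> Delta k A"
  unfolding Delta_def
proof (intro prod_nonneg)
  fix i assume i: "i \<in> {1..CARD('m) + CARD('n)}"
  define g where "g = a_mat (real CARD('n) * real k * ln 2) ** u_mat A"
  have L: "(\<lambda>x. a_mat (real CARD('n) * real k * ln 2) *v x) ` lattice_of A = (\<lambda>x. g *v x) ` int_vecs"
    unfolding g_def by (rule a_mat_image_lattice_of)
  have "det g \<noteq> 0" by (simp add: g_def det_a_mat_u_mat)
  then obtain B where B: "B \<subseteq> (\<lambda>x. g *v x) ` int_vecs" "independent B" "card B = CARD('m + 'n)"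
    by (rule lattice_full_rank)
  have "0 \<le> successive_min i ((\<lambda>x. g *v x) ` int_vecs)"
    using B i by (intro successive_min_nonneg[OF B(1,2)]) simp
  then show "0 \<le> min 1 (successive_min i ((\<lambda>x. a_mat (real CARD('n) * real k * ln 2) *v x) ` lattice_of A))"
    by (simp add: L)
qed

text \<open>If the bound failed for all large \<open>k\<close>, the nonnegative series would be
  dominated by a convergent geometric one.\<close>

lemma frequently_Delta_ge_if_divergent:
  assumes div: "LIM N sequentially. (\<Sum>k = 1..N. Delta k A) :> at_top" and "0 < e"
  shows "\<exists>\<^sub>F k in sequentially. 2 powr (- e * real k) \<le> Delta k A"
proof (rule ccontr)
  assume "\<not> ?thesis"
  then have ev: "\<forall>\<^sub>F k in sequentially. norm (Delta k A) \<le> (2 powr - e) ^ k"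
    by (simp add: not_frequently not_le Delta_nonneg powr_power mult.commute)
       (auto elim!: eventually_mono)
  have "summable (\<lambda>k. (2 powr - e) ^ k)"
    using \<open>0 < e\<close> by (intro summable_geometric) (simp add: powr_less_one)
  then have summ: "summable (\<lambda>k. Delta k A)"
    using ev by (rule summable_comparison_test_ev[rotated])
  have bound: "(\<Sum>k = 1..N. Delta k A) \<le> (\<Sum>k. Delta k A)" for N
    by (intro sum_le_suminf summ) (auto simp: Delta_nonneg)
  have "\<forall>\<^sub>F N in sequentially. (\<Sum>k. Delta k A) + 1 \<le> (\<Sum>k = 1..N. Delta k A)"
    using div unfolding filterlim_at_top by blast
  then obtain N where "(\<Sum>k. Delta k A) + 1 \<le> (\<Sum>k = 1..N. Delta k A)"
    by (auto simp: eventually_sequentially)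
  with bound[of N] show False by simp
qed

text \<open>At this time \<open>a_mat\<close> expands \<open>p + A q\<close> by
  \<open>2 powr (k n / m)\<close> and contracts \<open>q\<close> by \<open>2 ^ k\<close>. If
  \<open>q = 0\<close>, then \<open>p\<close> is a nonzero integer vector and is expanded; if
  \<open>|q| > Q\<close>, the contracted part still has norm at least 1; otherwise
  \<open>bad\<close> applies. Replacing \<open>Q\<close> by its upper bound \<open>2 ^ Suc k\<close>
  costs the factor \<open>2 powr (- n / m)\<close>.\<close>

lemma lattice_point_infnorm_ge:
  fixes A :: "real^'n^'m"
  assumes Q: "2 ^ k \<le> Q" "Q < 2 ^ Suc k" and "0 < \<epsilon>"
    and bad: "\<And>q. q \<in> int_vecs \<Longrightarrow> 0 < infnorm q \<Longrightarrow> infnorm q \<le> Q \<Longrightarrow>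
                \<epsilon> * Q powr (- real CARD('n) / real CARD('m)) \<le> dist_int (A *v q)"
    and x: "x \<in> int_vecs" "x \<noteq> 0"
  shows "min 1 (\<epsilon> * 2 powr (- real CARD('n) / real CARD('m)))
           \<le> infnorm (a_mat (real CARD('n) * real k * ln 2) *v (u_mat A *v x))"
proof -
  let ?\<alpha> = "real CARD('n) / real CARD('m)"
  define y where "y = a_mat (real CARD('n) * real k * ln 2) *v (u_mat A *v x)"
  define p q where "p = (\<chi> a. x $ Inl a)" and "q = (\<chi> c. x $ Inr c)"
  have pq: "p \<in> int_vecs" "q \<in> int_vecs" using x(1) by (auto simp: p_def q_def int_vecs_def)
  have yl: "y $ Inl i = 2 powr (?\<alpha> * real k) * (p + A *v q) $ i" for i
    by (simp add: y_def a_mat_mult_nth u_mat_mult_nth p_def q_def powr_def)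
  have yr: "y $ Inr j = q $ j / 2 ^ k" for j
    by (simp add: y_def a_mat_mult_nth u_mat_mult_nth q_def exp_minus field_simps exp_of_nat_mult)
  have y_ge_l: "2 powr (?\<alpha> * real k) * infnorm (p + A *v q) \<le> infnorm y"
  proof -
    have "infnorm (p + A *v q) \<le> infnorm y / 2 powr (?\<alpha> * real k)"
    proof (rule infnorm_le_cart)
      fix i
      have "2 powr (?\<alpha> * real k) * \<bar>(p + A *v q) $ i\<bar> \<le> infnorm y"
        using component_le_infnorm_cart[of y "Inl i"] unfolding yl abs_mult by simp
      then show "\<bar>(p + A *v q) $ i\<bar> \<le> infnorm y / 2 powr (?\<alpha> * real k)"
        by (subst pos_le_divide_eq) (simp_all add: mult.commute)
    qed
    then show ?thesis by (subst (asm) pos_le_divide_eq) (simp_all add: mult.commute)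
  qed
  have y_ge_r: "infnorm q / 2 ^ k \<le> infnorm y"
  proof -
    have "infnorm q \<le> infnorm y * 2 ^ k"
    proof (rule infnorm_le_cart)
      fix j
      show "\<bar>q $ j\<bar> \<le> infnorm y * 2 ^ k"
        using component_le_infnorm_cart[of y "Inr j"] unfolding yr by (simp add: field_simps)
    qed
    then show ?thesis by (simp add: field_simps)
  qed
  consider "q = 0" | "q \<noteq> 0" "infnorm q \<le> Q" | "Q < infnorm q" by linarith
  then have "min 1 (\<epsilon> * 2 powr (- ?\<alpha>)) \<le> infnorm y"
  proof cases
    case 1
    have "p \<noteq> 0"
    proof
      assume "p = 0"
      then have "x $ i = 0" for i using 1 by (cases i) (auto simp: p_def q_def vec_eq_iff)
      then show False using x(2) by (simp add: vec_eq_iff)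
    qed
    then have "1 \<le> infnorm p" using infnorm_int_vecs_ge_1 pq(1) by blast
    moreover have "1 \<le> 2 powr (?\<alpha> * real k)" by (intro ge_one_powr_ge_zero) auto
    ultimately have "1 * 1 \<le> 2 powr (?\<alpha> * real k) * infnorm p" by (intro mult_mono) auto
    then have "1 \<le> infnorm y" using y_ge_l 1 by simp
    then show ?thesis by simp
  next
    case 2
    have "0 < Q" using Q(1) by (rule less_le_trans[rotated]) simp
    have "(2 ^ Suc k) powr (- ?\<alpha>) = 2 powr (real (Suc k) * (- ?\<alpha>))"
      by (simp only: powr_realpow[of 2, symmetric] powr_powr zero_less_numeral)
    moreover have "a * real k + real (Suc k) * (- a) = - a" for a :: real
      by (simp add: algebra_simps)
    ultimately have "2 powr (- ?\<alpha>) = 2 powr (?\<alpha> * real k) * (2 ^ Suc k) powr (- ?\<alpha>)"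
      by (simp only: powr_add[symmetric])
    also have "\<dots> \<le> 2 powr (?\<alpha> * real k) * Q powr (- ?\<alpha>)"
      using Q \<open>0 < Q\<close> by (intro mult_left_mono powr_mono2') auto
    finally have "\<epsilon> * 2 powr (- ?\<alpha>) \<le> \<epsilon> * (2 powr (?\<alpha> * real k) * Q powr (- ?\<alpha>))"
      using \<open>0 < \<epsilon>\<close> by (intro mult_left_mono) auto
    also have "\<dots> = 2 powr (?\<alpha> * real k) * (\<epsilon> * Q powr (- ?\<alpha>))" by simp
    also have "\<dots> \<le> 2 powr (?\<alpha> * real k) * infnorm (p + A *v q)"
    proof (rule mult_left_mono)
      have "\<epsilon> * Q powr (- ?\<alpha>) \<le> dist_int (A *v q)"
        using bad[OF pq(2)] 2 by (simp add: infnorm_pos_lt)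
      also have "\<dots> \<le> infnorm (A *v q - (- p))"
        using pq(1) by (intro dist_int_le int_vecs_uminus)
      also have "A *v q - (- p) = p + A *v q" by simp
      finally show "\<epsilon> * Q powr (- ?\<alpha>) \<le> infnorm (p + A *v q)" .
    qed simp
    also note y_ge_l
    finally show ?thesis by simp
  next
    case 3
    have "1 \<le> infnorm q / 2 ^ k" using 3 Q(1) by simp
    also note y_ge_r
    finally show ?thesis by (rule min.coboundedI1)
  qed
  then show ?thesis by (simp add: y_def)
qed

text \<open>Nonsingularity gives arbitrarily large \<open>Q\<close> without good approximations. At
  the dyadic scale of such a \<open>Q\<close> all nonzero lattice vectors have norm at least a fixed
  \<open>c\<close>, hence \<open>Delta k A \<ge> c ^ d\<close>, and a positive constant eventually
  exceeds \<open>2 powr (- e k)\<close>.\<close>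

lemma frequently_Delta_ge_if_nonsingular:
  fixes A :: "real^'n^'m"
  assumes "\<not> singular_matrix A" "0 < e"
  shows "\<exists>\<^sub>F k in sequentially. 2 powr (- e * real k) \<le> Delta k A"
proof -
  let ?d = "CARD('m) + CARD('n)"
  obtain \<epsilon> where "0 < \<epsilon>" and freq: "\<exists>\<^sub>F Q in at_top. \<forall>q\<in>int_vecs. 0 < infnorm q \<and> infnorm q \<le> Q \<longrightarrow>
      \<epsilon> * Q powr (- real CARD('n) / real CARD('m)) \<le> dist_int (A *v q)"
  proof -
    obtain \<epsilon> where "0 < \<epsilon>" and "\<not> (\<forall>\<^sub>F Q in at_top. \<exists>q\<in>int_vecs. 0 < infnorm q \<and> infnorm q \<le> Q \<and>
        dist_int (A *v q) < \<epsilon> * Q powr (- real CARD('n) / real CARD('m)))"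
      using assms(1) unfolding singular_matrix_def by blast
    then have "\<exists>\<^sub>F Q in at_top. \<not> (\<exists>q\<in>int_vecs. 0 < infnorm q \<and> infnorm q \<le> Q \<and>
        dist_int (A *v q) < \<epsilon> * Q powr (- real CARD('n) / real CARD('m)))"
      by (simp only: not_eventually)
    then have "\<exists>\<^sub>F Q in at_top. \<forall>q\<in>int_vecs. 0 < infnorm q \<and> infnorm q \<le> Q \<longrightarrow>
        \<epsilon> * Q powr (- real CARD('n) / real CARD('m)) \<le> dist_int (A *v q)"
      by (rule frequently_elim1) (meson not_less)
    then show ?thesis using \<open>0 < \<epsilon>\<close> that by blast
  qed
  define c where "c = min 1 (\<epsilon> * 2 powr (- real CARD('n) / real CARD('m)))"
  have c: "0 < c" "c \<le> 1" using \<open>0 < \<epsilon>\<close> by (simp_all add: c_def)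
  have "\<exists>\<^sub>F k in sequentially. c ^ ?d \<le> Delta k A"
    unfolding frequently_sequentially
  proof
    fix k0
    obtain Q where Q: "2 ^ Suc k0 \<le> Q" and bad: "\<And>q. q \<in> int_vecs \<Longrightarrow> 0 < infnorm q \<Longrightarrow> infnorm q \<le> Q \<Longrightarrow>
      \<epsilon> * Q powr (- real CARD('n) / real CARD('m)) \<le> dist_int (A *v q)"
      using frequently_ex[OF frequently_eventually_frequently[OF freq eventually_ge_at_top[of "2 ^ Suc k0"]]]
      by blast
    have "\<exists>k\<ge>k0. 2 ^ k \<le> Q \<and> Q < 2 ^ Suc k"
    proof -
      obtain j where j: "Q < 2 ^ j" using real_arch_pow[of 2 Q] by auto
      \<comment> \<open>Minimality yields \<open>2 ^ k \<le> Q\<close> by inspecting the predecessor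
        of \<open>k\<close>; the choice \<open>Q \<ge> 2 ^ Suc k0\<close> guarantees that it exists
        and that \<open>k\<close> exceeds \<open>k0\<close>.\<close>
      define k where "k = (LEAST k. Q < 2 ^ Suc k)"
      have "Q < 2 ^ Suc j" using j by (rule less_le_trans) (intro power_increasing, auto)
      then have k: "Q < 2 ^ Suc k" unfolding k_def by (rule LeastI)
      have "k0 < k"
      proof (rule ccontr)
        assume "\<not> k0 < k"
        then have "(2::real) ^ Suc k \<le> 2 ^ Suc k0" by (intro power_increasing) auto
        with k Q show False by linarith
      qed
      then obtain k' where k': "k = Suc k'" by (cases k) auto
      have "2 ^ k \<le> Q"
        using not_less_Least[of k' "\<lambda>k. Q < 2 ^ Suc k"] unfolding k_def[symmetric] k' by (simp add: not_less)
      with k \<open>k0 < k\<close> show ?thesis by (intro exI[of _ k]) auto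
    qed
    then obtain k where k: "k0 \<le> k" "2 ^ k \<le> Q" "Q < 2 ^ Suc k" by blast
    define g where "g = a_mat (real CARD('n) * real k * ln 2) ** u_mat A"
    have L: "(\<lambda>x. a_mat (real CARD('n) * real k * ln 2) *v x) ` lattice_of A = (\<lambda>x. g *v x) ` int_vecs"
      unfolding g_def by (rule a_mat_image_lattice_of)
    have "det g \<noteq> 0" by (simp add: g_def det_a_mat_u_mat)
    then obtain B where B: "B \<subseteq> (\<lambda>x. g *v x) ` int_vecs" "independent B" "card B = CARD('m + 'n)"
      by (rule lattice_full_rank)
    have lam: "c \<le> successive_min i ((\<lambda>x. g *v x) ` int_vecs)" if i: "i \<in> {1..?d}" for i
    proof (rule dense_ge)
      fix \<rho> assume "successive_min i ((\<lambda>x. g *v x) ` int_vecs) < \<rho>"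
      then obtain S where S: "S \<subseteq> (\<lambda>x. g *v x) ` int_vecs" "independent S" "card S = i"
        "\<And>x j. x \<in> S \<Longrightarrow> \<bar>x $ j\<bar> \<le> \<rho>"
        using successive_min_less_obtain[OF B(1,2), of i \<rho>] B(3) i by auto
      have "S \<noteq> {}" using S(3) i by auto
      then obtain y where "y \<in> S" by blast
      then obtain x where x: "x \<in> int_vecs" "y = g *v x" using S(1) by blast
      have "x \<noteq> 0" using \<open>y \<in> S\<close> S(2) dependent_zero x(2) by force
      have "c \<le> infnorm y"
        unfolding c_def x(2) g_def matrix_vector_mul_assoc[symmetric]
        using k(2,3) \<open>0 < \<epsilon>\<close> bad x(1) \<open>x \<noteq> 0\<close> by (rule lattice_point_infnorm_ge)
      also have "\<dots> \<le> \<rho>" using S(4)[OF \<open>y \<in> S\<close>] by (rule infnorm_le_cart)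
      finally show "c \<le> \<rho>" .
    qed
    have "c ^ ?d = (\<Prod>i = 1..?d. c)" by simp
    also have "\<dots> \<le> Delta k A"
      unfolding Delta_def L using c lam by (intro prod_mono) auto
    finally show "\<exists>k\<ge>k0. c ^ ?d \<le> Delta k A" using k(1) by blast
  qed
  moreover have "\<forall>\<^sub>F k in sequentially. 1 / c ^ ?d \<le> 2 powr (e * real k)"
    by (rule two_powr_eventually_ge) fact
  ultimately have "\<exists>\<^sub>F k in sequentially. c ^ ?d \<le> Delta k A \<and> 1 / c ^ ?d \<le> 2 powr (e * real k)"
    by (rule frequently_eventually_frequently)
  then show ?thesis
  proof (rule frequently_elim1)
    fix k assume k: "c ^ ?d \<le> Delta k A \<and> 1 / c ^ ?d \<le> 2 powr (e * real k)"
    have "0 < c ^ ?d" using c(1) by simp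
    then have "2 powr (- e * real k) \<le> c ^ ?d"
      using k by (simp add: powr_minus field_simps)
    with k show "2 powr (- e * real k) \<le> Delta k A" by linarith
  qed
qed

theorem corollary3p2:
  fixes A :: "real^'n^'m"
  shows "((LIM N sequentially. (\<Sum>k = 1..N. Delta k A) :> at_top) \<longrightarrow>
            (\<forall>v>0. hausdorff_dim (W A (\<lambda>q. q powr (- v))) =
                     ereal (min (real CARD('m)) (real CARD('n) / v)))) \<and>
         (\<not> singular_matrix A \<longrightarrow>
            (\<forall>v>0. hausdorff_dim (W A (\<lambda>q. q powr (- v))) =
                     ereal (min (real CARD('m)) (real CARD('n) / v))))"
  using hausdorff_dim_W[of A] frequently_Delta_ge_if_divergent[of A]
    frequently_Delta_ge_if_nonsingular[of A] by blast

end
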